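(* Let $q \in (0,1]$. The pair $(\mathrm{Lip}_q(S^1), L_q)$ is a quantum metric on $C(S^1)$.
   Context: **$q$-integers.** For $q\in(0,1)$ and $n\in\mathbb{Z}$ put $[n]_q := \frac{q^n-q^{-n}}{q-q^{-1}}$; for $q=1$ put $[n]_1 := n$. **Identification of $C(S^1)$.** $\ell^2(\mathbb{Z})$ has standard orthonormal basis $(e_j)_{j\in\mathbb{Z}}$, inner products are linear in the second variable, and $\|\cdot\|_\infty$ denotes the operator norm. For a bounded operator $T$ on $\ell^2(\mathbb{Z})$ write $T_{jk} := \langle e_j, Te_k\rangle$. Let $U$ be the bilateral shift, $U e_j = e_{j+1}$. The $C^*$-algebra $C(S^1)$ of continuous complex functions on the unit circle $S^1\subseteq\mathbb{C}$ is identified with $C^*(U)\subseteq \mathbb{B}(\ell^2(\mathbb{Z}))$ via $z\mapsto U$, where $z:S^1\to\mathbb{C}$ is the inclusion. **$q$-derivative.** $\mathrm{Lip}_q(\ell^2(\mathbb{Z}))$ is the set of bounded operators $T$ on $\ell^2(\mathbb{Z})$ such that the infinite matrix $(i[j-k]_q T_{jk})_{j,k\in\mathbb{Z}}$ is the matrix of a bounded operator; this bounded operator is denoted $\mathrm{d}_q(T)$. Put $\mathrm{Lip}_q(S^1) := C(S^1)\cap \mathrm{Lip}_q(\ell^2(\mathbb{Z}))$ (an operator system) and $L_q(T):=\|\mathrm{d}_q(T)\|_\infty$. **Compact quantum metric spaces.** An operator system $\mathcal{X}$ is a (not necessarily closed) $*$-invariant subspace containing $1$ of a unital $C^*$-algebra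 $A$; $X$ denotes its norm closure in $A$. A slip-norm on $\mathcal{X}$ is a seminorm $L:\mathcal{X}\to[0,\infty)$ with $L(x^* )=L(x)$ for all $x$ and $L(1)=0$. The state space $S(\mathcal{X})$ is the set of unital positive linear functionals on $\mathcal{X}$, and the Monge-Kantorovich metric is $\rho_L(\varphi,\psi)=\sup\{|\varphi(x)-\psi(x)| : x\in\mathcal{X},\ L(x)\le 1\}\in[0,\infty]$. The pair $(\mathcal{X},L)$ is a compact quantum metric space if the topology induced by $\rho_L$ on $S(\mathcal{X})$ agrees with the weak-$*$ topology; in this case $(\mathcal{X},L)$ is said to be a quantum metric on $X$. *)

theory Defs
  imports "HOL-Analysis.Analysis"
begin

section \<open>The Hilbert space $\ell^2(\mathbb{Z})$\<close>

typedef ell2 = "{f :: int \<Rightarrow> complex. (\<lambda>j. (cmod (f j))\<^sup>2) summable_on UNIV}"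
  morphisms coord Abs_ell2
  by (rule exI[of _ "\<lambda>_. 0"]) simp

lemma coord_summable: "(\<lambda>j. (cmod (coord v j))\<^sup>2) summable_on UNIV"
  using coord by auto

lemma ell2_eqI: "(\<And>j. coord v j = coord w j) \<Longrightarrow> v = w"
  by (metis coord_inject ext)

lemma sq_summable_add:
  fixes f g :: "int \<Rightarrow> complex"
  assumes "(\<lambda>j. (cmod (f j))\<^sup>2) summable_on UNIV" "(\<lambda>j. (cmod (g j))\<^sup>2) summable_on UNIV"
  shows "(\<lambda>j. (cmod (f j + g j))\<^sup>2) summable_on UNIV"
proof (rule summable_on_comparison_test)
  show "(\<lambda>j. 2 * (cmod (f j))\<^sup>2 + 2 * (cmod (g j))\<^sup>2) summable_on UNIV"
    by (intro summable_on_add summable_on_cmult_right assms)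
  fix j
  have "(cmod (f j + g j))\<^sup>2 \<le> (cmod (f j) + cmod (g j))\<^sup>2"
    by (intro power_mono norm_triangle_ineq) simp
  also have "\<dots> \<le> 2 * (cmod (f j))\<^sup>2 + 2 * (cmod (g j))\<^sup>2"
    using sum_squares_bound[of "cmod (f j)" "cmod (g j)"]
    by (simp add: power2_sum)
  finally show "(cmod (f j + g j))\<^sup>2 \<le> 2 * (cmod (f j))\<^sup>2 + 2 * (cmod (g j))\<^sup>2" .
qed simp

lemma sq_summable_scale:
  fixes f :: "int \<Rightarrow> complex"
  assumes "(\<lambda>j. (cmod (f j))\<^sup>2) summable_on UNIV"
  shows "(\<lambda>j. (cmod (c * f j))\<^sup>2) summable_on UNIV"
  using summable_on_cmult_right[OF assms, of "(cmod c)\<^sup>2"]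
  by (simp add: norm_mult power_mult_distrib)

text \<open>Linear in the second variable.\<close>

definition cinner :: "ell2 \<Rightarrow> ell2 \<Rightarrow> complex" where
  "cinner v w = (\<Sum>\<^sub>\<infinity>j. cnj (coord v j) * coord w j)"

lemma cinner_summable: "(\<lambda>j. cnj (coord v j) * coord w j) summable_on UNIV"
proof (rule abs_summable_summable, rule summable_on_comparison_test)
  show "(\<lambda>j. (cmod (coord v j))\<^sup>2 + (cmod (coord w j))\<^sup>2) summable_on UNIV"
    by (intro summable_on_add coord_summable)
  fix j
  have "0 \<le> cmod (coord v j) * cmod (coord w j)" by simp
  then show "norm (cnj (coord v j) * coord w j) \<le> (cmod (coord v j))\<^sup>2 + (cmod (coord w j))\<^sup>2"
    using sum_squares_bound[of "cmod (coord v j)" "cmod (coord w j)"]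
    unfolding norm_mult complex_mod_cnj by linarith
qed simp

definition scaleC :: "complex \<Rightarrow> ell2 \<Rightarrow> ell2"  (infixr "*\<^sub>C" 75) where
  "c *\<^sub>C v = Abs_ell2 (\<lambda>j. c * coord v j)"

lemma coord_scaleC [simp]: "coord (c *\<^sub>C v) j = c * coord v j"
  unfolding scaleC_def by (subst Abs_ell2_inverse) (auto intro: sq_summable_scale coord_summable)

instantiation ell2 :: real_inner
begin

definition "0 = Abs_ell2 (\<lambda>_. 0)"
definition "v + w = Abs_ell2 (\<lambda>j. coord v j + coord w j)"
definition "- v = (- 1 :: complex) *\<^sub>C v"
definition "v - w = v + (- w :: ell2)"
definition "r *\<^sub>R v = complex_of_real r *\<^sub>C v"
definition "inner v w = Re (cinner v w)"
definition "norm v = sqrt (\<Sum>\<^sub>\<infinity>j. (cmod (coord v j))\<^sup>2)"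
definition "dist v w = norm (v - w :: ell2)"
definition "sgn v = inverse (norm v) *\<^sub>R (v :: ell2)"
definition "uniformity = (INF e\<in>{0<..}. principal {(v, w :: ell2). dist v w < e})"
definition "open S = (\<forall>v\<in>S. \<forall>\<^sub>F (v', w) in uniformity. v' = v \<longrightarrow> (w :: ell2) \<in> S)"

lemma coord_zero [simp]: "coord 0 j = 0"
  unfolding zero_ell2_def by (subst Abs_ell2_inverse) auto

lemma coord_add [simp]: "coord (v + w) j = coord v j + coord w j"
  unfolding plus_ell2_def
  by (subst Abs_ell2_inverse) (auto intro: sq_summable_add coord_summable)

lemma coord_uminus [simp]: "coord (- v) j = - coord v j"
  unfolding uminus_ell2_def by simp

lemma coord_diff [simp]: "coord (v - w) j = coord v j - coord w j"
  unfolding minus_ell2_def by simp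

lemma coord_scaleR [simp]: "coord (r *\<^sub>R v) j = complex_of_real r * coord v j"
  unfolding scaleR_ell2_def by simp

lemma cinner_self: "cinner v v = complex_of_real (\<Sum>\<^sub>\<infinity>j. (cmod (coord v j))\<^sup>2)"
proof -
  have "((\<lambda>j. complex_of_real ((cmod (coord v j))\<^sup>2)) has_sum
          complex_of_real (\<Sum>\<^sub>\<infinity>j. (cmod (coord v j))\<^sup>2)) UNIV"
    by (intro has_sum_of_real has_sum_infsum coord_summable)
  moreover have "complex_of_real ((cmod (coord v j))\<^sup>2) = cnj (coord v j) * coord v j" for j
    by (subst complex_norm_square) simp
  ultimately show ?thesis
    unfolding cinner_def by (simp add: infsumI)
qed

lemma cinner_commute: "cinner w v = cnj (cinner v w)"
  unfolding cinner_def by (simp flip: infsum_cnj add: mult.commute)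

lemma cinner_add_right: "cinner u (v + w) = cinner u v + cinner u w"
  unfolding cinner_def by (simp add: distrib_left infsum_add cinner_summable)

lemma cinner_scaleC_right: "cinner u (c *\<^sub>C v) = c * cinner u v"
  unfolding cinner_def by (simp flip: infsum_cmult_right' add: mult.left_commute)

instance
proof
  fix u v w :: ell2 and r s :: real
  show "u + v + w = u + (v + w)" "v + w = w + v" "0 + v = v" "- v + v = 0" "v - w = v + - w"
    "r *\<^sub>R (v + w) = r *\<^sub>R v + r *\<^sub>R w" "(r + s) *\<^sub>R v = r *\<^sub>R v + s *\<^sub>R v"
    "r *\<^sub>R s *\<^sub>R v = (r * s) *\<^sub>R v" "1 *\<^sub>R v = v"
    by (auto intro!: ell2_eqI simp: algebra_simps)
  show "inner v w = inner w v"
    unfolding inner_ell2_def by (subst cinner_commute) simp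
  then show "inner (u + v) w = inner u w + inner v w"
    unfolding inner_ell2_def
    by (metis cinner_commute cinner_add_right cnj.simps(1) plus_complex.simps(1))
  show "inner (r *\<^sub>R v) w = r * inner v w"
    unfolding inner_ell2_def scaleR_ell2_def
    by (subst (1 2) cinner_commute) (simp add: cinner_scaleC_right)
  have nn: "0 \<le> (\<Sum>\<^sub>\<infinity>j. (cmod (coord v j))\<^sup>2)"
    by (simp add: infsum_nonneg)
  have eq: "inner v v = (\<Sum>\<^sub>\<infinity>j. (cmod (coord v j))\<^sup>2)"
    unfolding inner_ell2_def by (simp add: cinner_self)
  show "0 \<le> inner v v" using nn eq by simp
  show "norm v = sqrt (inner v v)" using eq by (simp add: norm_ell2_def)
  show "(inner v v = 0) = (v = 0)"
  proof
    assume "inner v v = 0"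
    then have "(cmod (coord v j))\<^sup>2 = 0" for j
      using nonneg_infsum_le_0D[of "\<lambda>j. (cmod (coord v j))\<^sup>2" UNIV j] eq coord_summable[of v]
      by simp
    then show "v = 0" by (intro ell2_eqI) simp
  next
    assume "v = 0"
    then show "inner v v = 0" by (subst eq) simp
  qed
qed (fact dist_ell2_def sgn_ell2_def uniformity_ell2_def open_ell2_def)+

end

definition basis_vec :: "int \<Rightarrow> ell2" where
  "basis_vec j = Abs_ell2 (\<lambda>k. if k = j then 1 else 0)"

lemma coord_basis_vec: "coord (basis_vec j) k = (if k = j then 1 else 0)"
proof -
  have "(\<lambda>k. (cmod (if k = j then 1 else 0))\<^sup>2) summable_on UNIV
      \<longleftrightarrow> (\<lambda>k. 1 :: real) summable_on {j}"
    by (rule summable_on_cong_neutral) auto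
  then show ?thesis
    unfolding basis_vec_def by (subst Abs_ell2_inverse) auto
qed

lemma norm_scaleC: "norm (c *\<^sub>C v) = cmod c * norm (v :: ell2)"
  unfolding norm_ell2_def
  by (simp add: norm_mult power_mult_distrib infsum_cmult_right' real_sqrt_mult)


section \<open>Bounded operators on $\ell^2(\mathbb{Z})$\<close>

text \<open>
  The elements of the library type \<^typ>\<open>ell2 \<Rightarrow>\<^sub>L ell2\<close> are the bounded \<^emph>\<open>real\<close>-linear operators, with the
  operator norm; the bounded operators of the text are the complex-linear ones among them.
\<close>

type_synonym op2 = "ell2 \<Rightarrow>\<^sub>L ell2"

definition bounded_ops :: "op2 set" where
  "bounded_ops = {T. \<forall>c v. blinfun_apply T (c *\<^sub>C v) = c *\<^sub>C blinfun_apply T v}"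

definition scale_op :: "complex \<Rightarrow> op2 \<Rightarrow> op2" where
  "scale_op c T = Blinfun (\<lambda>v. c *\<^sub>C blinfun_apply T v)"

lemma bounded_linear_scaleC: "bounded_linear (\<lambda>v. c *\<^sub>C v)"
proof (rule bounded_linear_intro)
  show "c *\<^sub>C (v + w) = c *\<^sub>C v + c *\<^sub>C w" "c *\<^sub>C r *\<^sub>R v = r *\<^sub>R c *\<^sub>C v" for v w :: ell2 and r :: real
    by (auto intro!: ell2_eqI simp: algebra_simps)
  show "norm (c *\<^sub>C v) \<le> norm v * cmod c" for v
    by (simp add: norm_scaleC)
qed

lemma scale_op_apply: "blinfun_apply (scale_op c T) v = c *\<^sub>C blinfun_apply T v"
  unfolding scale_op_def
  by (subst bounded_linear_Blinfun_apply)
    (auto intro: bounded_linear_compose[OF bounded_linear_scaleC] blinfun.bounded_linear_right)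

definition adj :: "op2 \<Rightarrow> op2" where
  "adj T = (THE S. S \<in> bounded_ops \<and>
     (\<forall>v w. cinner (blinfun_apply S v) w = cinner v (blinfun_apply T w)))"

definition entry :: "op2 \<Rightarrow> int \<Rightarrow> int \<Rightarrow> complex" where
  "entry T j k = cinner (basis_vec j) (blinfun_apply T (basis_vec k))"

definition bilateral_shift :: op2 where
  "bilateral_shift = Blinfun (\<lambda>v. Abs_ell2 (\<lambda>j. coord v (j - 1)))"

lemma bij_shift: "bij_betw (\<lambda>j :: int. j - 1) UNIV UNIV"
  by (rule bij_betwI[where g = "\<lambda>j. j + 1"]) auto

lemma coord_shift: "coord (Abs_ell2 (\<lambda>j. coord v (j - 1))) j = coord v (j - 1)"
  using coord_summable[of v] summable_on_reindex_bij_betw[OF bij_shift, of "\<lambda>j. (cmod (coord v j))\<^sup>2"]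
  by (subst Abs_ell2_inverse) auto

lemma coord_bilateral_shift:
  "coord (blinfun_apply bilateral_shift v) j = coord v (j - 1)"
proof -
  have "norm (Abs_ell2 (\<lambda>j. coord w (j - 1))) = norm w" for w
    using infsum_reindex_bij_betw[OF bij_shift, of "\<lambda>j. (cmod (coord w j))\<^sup>2"]
    by (simp add: norm_ell2_def coord_shift)
  then have "bounded_linear (\<lambda>v. Abs_ell2 (\<lambda>j. coord v (j - 1)))"
    by (intro bounded_linear_intro[where K = 1])
      (auto intro!: ell2_eqI simp: coord_shift simp del: coord_add coord_scaleR, simp_all add: coord_shift)
  then show ?thesis
    by (simp add: bilateral_shift_def bounded_linear_Blinfun_apply coord_shift)
qed

lemma bilateral_shift_basis_vec:
  "blinfun_apply bilateral_shift (basis_vec j) = basis_vec (j + 1)"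
  by (rule ell2_eqI) (auto simp: coord_bilateral_shift coord_basis_vec)


section \<open>Unital $C^*$-algebras of operators and operator systems\<close>

definition complex_subspace :: "op2 set \<Rightarrow> bool" where
  "complex_subspace X \<longleftrightarrow> 0 \<in> X \<and> (\<forall>x\<in>X. \<forall>y\<in>X. x + y \<in> X) \<and> (\<forall>c. \<forall>x\<in>X. scale_op c x \<in> X)"

definition unital_cstar_algebra :: "op2 set \<Rightarrow> bool" where
  "unital_cstar_algebra A \<longleftrightarrow> A \<subseteq> bounded_ops \<and> complex_subspace A \<and> id_blinfun \<in> A \<and>
     (\<forall>x\<in>A. \<forall>y\<in>A. x o\<^sub>L y \<in> A) \<and> (\<forall>x\<in>A. adj x \<in> A) \<and> closed A"

definition cstar_generated :: "op2 set \<Rightarrow> op2 set" where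
  "cstar_generated G = \<Inter>{A. unital_cstar_algebra A \<and> G \<subseteq> A}"

definition operator_system :: "op2 set \<Rightarrow> op2 set \<Rightarrow> bool" where
  "operator_system A X \<longleftrightarrow> unital_cstar_algebra A \<and> X \<subseteq> A \<and> complex_subspace X \<and>
     (\<forall>x\<in>X. adj x \<in> X) \<and> id_blinfun \<in> X"

definition positive_in :: "op2 set \<Rightarrow> op2 \<Rightarrow> bool" where
  "positive_in A x \<longleftrightarrow> (\<exists>y\<in>A. x = adj y o\<^sub>L y)"


section \<open>Compact quantum metric spaces\<close>

definition slip_norm :: "op2 set \<Rightarrow> (op2 \<Rightarrow> real) \<Rightarrow> bool" where
  "slip_norm X L \<longleftrightarrow>
     (\<forall>x\<in>X. 0 \<le> L x) \<and>
     (\<forall>x\<in>X. \<forall>y\<in>X. L (x + y) \<le> L x + L y) \<and>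
     (\<forall>c. \<forall>x\<in>X. L (scale_op c x) = cmod c * L x) \<and>
     (\<forall>x\<in>X. L (adj x) = L x) \<and>
     L id_blinfun = 0"

text \<open>
  A functional on \<open>X\<close> is a function that is \<^const>\<open>undefined\<close> outside \<open>X\<close>, so that distinct
  elements of the state space are distinct as functionals on \<open>X\<close>.
\<close>

definition state_space :: "op2 set \<Rightarrow> op2 set \<Rightarrow> (op2 \<Rightarrow> complex) set" where
  "state_space A X = {\<phi> \<in> extensional X.
     (\<forall>x\<in>X. \<forall>y\<in>X. \<phi> (x + y) = \<phi> x + \<phi> y) \<and>
     (\<forall>c. \<forall>x\<in>X. \<phi> (scale_op c x) = c * \<phi> x) \<and>
     (\<forall>x\<in>X. positive_in A x \<longrightarrow> \<phi> x \<in> \<real>\<^sub>\<ge>\<^sub>0) \<and>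
     \<phi> id_blinfun = 1}"

definition weak_star_topology :: "op2 set \<Rightarrow> op2 set \<Rightarrow> (op2 \<Rightarrow> complex) topology" where
  "weak_star_topology A X =
     subtopology (product_topology (\<lambda>_. euclidean) X) (state_space A X)"

definition mk_dist ::
  "op2 set \<Rightarrow> (op2 \<Rightarrow> real) \<Rightarrow> (op2 \<Rightarrow> complex) \<Rightarrow> (op2 \<Rightarrow> complex) \<Rightarrow> ennreal" where
  "mk_dist X L \<phi> \<psi> = (SUP x\<in>{x \<in> X. L x \<le> 1}. ennreal (cmod (\<phi> x - \<psi> x)))"

text \<open>
  As \<^const>\<open>mk_dist\<close> may be infinite, the library's metric spaces do not apply; the open sets
  are those containing, around each of their points, a ball of positive finite radius.
\<close>

definition mk_topology :: "op2 set \<Rightarrow> op2 set \<Rightarrow> (op2 \<Rightarrow> real) \<Rightarrow> (op2 \<Rightarrow> complex) topology" where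
  "mk_topology A X L = topology (\<lambda>W. W \<subseteq> state_space A X \<and>
     (\<forall>\<phi>\<in>W. \<exists>\<epsilon>>0. \<forall>\<psi>\<in>state_space A X. mk_dist X L \<phi> \<psi> < ennreal \<epsilon> \<longrightarrow> \<psi> \<in> W))"

lemma openin_mk_topology:
  "openin (mk_topology A X L) W \<longleftrightarrow> W \<subseteq> state_space A X \<and>
     (\<forall>\<phi>\<in>W. \<exists>\<epsilon>>0. \<forall>\<psi>\<in>state_space A X. mk_dist X L \<phi> \<psi> < ennreal \<epsilon> \<longrightarrow> \<psi> \<in> W)"
proof -
  let ?P = "\<lambda>W. W \<subseteq> state_space A X \<and>
     (\<forall>\<phi>\<in>W. \<exists>\<epsilon>>0. \<forall>\<psi>\<in>state_space A X. mk_dist X L \<phi> \<psi> < ennreal \<epsilon> \<longrightarrow> \<psi> \<in> W)"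
  have "?P (V \<inter> W)" if V: "?P V" and W: "?P W" for V W
  proof (intro conjI ballI)
    fix \<phi> assume "\<phi> \<in> V \<inter> W"
    with V W obtain d e where d: "d > 0" "\<forall>\<psi>\<in>state_space A X. mk_dist X L \<phi> \<psi> < ennreal d \<longrightarrow> \<psi> \<in> V"
      and e: "e > 0" "\<forall>\<psi>\<in>state_space A X. mk_dist X L \<phi> \<psi> < ennreal e \<longrightarrow> \<psi> \<in> W"
      by blast
    have "ennreal (min d e) \<le> ennreal d" "ennreal (min d e) \<le> ennreal e"
      by (auto intro: ennreal_leI)
    then have "\<forall>\<psi>\<in>state_space A X. mk_dist X L \<phi> \<psi> < ennreal (min d e) \<longrightarrow> \<psi> \<in> V \<inter> W"
      using d e by (meson IntI less_le_trans)
    then show "\<exists>\<epsilon>>0. \<forall>\<psi>\<in>state_space A X. mk_dist X L \<phi> \<psi> < ennreal \<epsilon> \<longrightarrow> \<psi> \<in> V \<inter> W"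
      using d(1) e(1) by (intro exI[of _ "min d e"]) auto
  qed (use V in blast)
  moreover have "?P (\<Union>\<K>)" if "\<forall>W\<in>\<K>. ?P W" for \<K>
    using that by (meson Union_iff Union_least)
  ultimately have "istopology ?P"
    unfolding istopology_def by blast
  then show ?thesis
    unfolding mk_topology_def by (simp add: topology_inverse')
qed

definition compact_quantum_metric_space :: "op2 set \<Rightarrow> op2 set \<Rightarrow> (op2 \<Rightarrow> real) \<Rightarrow> bool" where
  "compact_quantum_metric_space A X L \<longleftrightarrow>
     operator_system A X \<and> slip_norm X L \<and> mk_topology A X L = weak_star_topology A X"

text \<open>The pair \<open>(X, L)\<close>, with \<open>X\<close> inside the unital $C^*$-algebra \<open>A\<close>, is a quantum metric on \<open>Y\<close>.\<close>

definition quantum_metric_on :: "op2 set \<Rightarrow> op2 set \<Rightarrow> (op2 \<Rightarrow> real) \<Rightarrow> op2 set \<Rightarrow> bool" where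
  "quantum_metric_on A X L Y \<longleftrightarrow> compact_quantum_metric_space A X L \<and> closure X = Y"


section \<open>The circle and the \<open>q\<close>-derivative\<close>

text \<open>The continuous functions on the circle, identified with $C^*(U)$ by sending the inclusion
  $z : S^1 \to \mathbb{C}$ to the bilateral shift $U$.\<close>

definition C_circle :: "op2 set" where
  "C_circle = cstar_generated {bilateral_shift}"

definition q_int :: "real \<Rightarrow> int \<Rightarrow> real" where
  "q_int q n = (if q = 1 then of_int n else (q powi n - q powi (- n)) / (q - inverse q))"

definition is_q_derivative :: "real \<Rightarrow> op2 \<Rightarrow> op2 \<Rightarrow> bool" where
  "is_q_derivative q T D \<longleftrightarrow> D \<in> bounded_ops \<and>
     (\<forall>j k. entry D j k = \<i> * complex_of_real (q_int q (j - k)) * entry T j k)"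

definition Lip_ell2 :: "real \<Rightarrow> op2 set" where
  "Lip_ell2 q = {T \<in> bounded_ops. \<exists>D. is_q_derivative q T D}"

definition q_deriv :: "real \<Rightarrow> op2 \<Rightarrow> op2" where
  "q_deriv q T = (THE D. is_q_derivative q T D)"

definition Lip_circle :: "real \<Rightarrow> op2 set" where
  "Lip_circle q = C_circle \<inter> Lip_ell2 q"

definition L_q :: "real \<Rightarrow> op2 \<Rightarrow> real" where
  "L_q q T = norm (q_deriv q T)"

end

theory Submission
  imports Defs
begin

text \<open>
  The metric topology agrees with the weak-\<open>*\<close> topology as soon as the unit ball of \<open>L\<close> is totally
  bounded modulo scalars (\<open>compact_quantum_metric_spaceI\<close>; this is the direction of Rieffel's
  criterion that matters here). For the circle, total boundedness is an estimate on Fourier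
  coefficients that is uniform in \<open>q\<close>.

  An element \<open>T\<close> of \<open>C(S\<^sup>1)\<close> is constant along diagonals, with entries \<open>t\<^sub>j\<^sub>-\<^sub>k\<close>, because this holds for
  the Laurent polynomials in the shift, of which the algebra is the closure. Applying \<open>d\<^sub>q(T)\<close> to \<open>e\<^sub>0\<close>
  gives \<open>\<Sum>\<^sub>n \<bar>[n]\<^sub>q\<bar>\<^sup>2 \<bar>t\<^sub>n\<bar>\<^sup>2 \<le> L\<^sub>q(T)\<^sup>2\<close>, and \<open>\<bar>[n]\<^sub>q\<bar> \<ge> \<bar>n\<bar>\<close> for every \<open>q\<close> in \<open>(0,1]\<close>. By
  Cauchy-Schwarz against \<open>\<Sum> 1/n\<^sup>2\<close>, the tails of \<open>\<Sum> \<bar>t\<^sub>n\<bar>\<close> tend to zero uniformly on the Lipschitz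
  ball. These sums dominate operator norms (\<open>norm_le_sum_Fourier\<close>), so the ball lies uniformly
  close to trigonometric polynomials with frequencies in one finite set; apart from the constant term, their
  coefficients have modulus at most \<open>1\<close>, which leaves a compact set (\<open>Lip_ball_finite_net\<close>).

  The criterion needs states to be bounded for the operator norm. As positivity means being of the form
  \<open>y\<^sup>* y\<close>, this requires square roots of \<open>1 - x\<close> for small self-adjoint \<open>x\<close>, which come from Banach's
  fixed point theorem (\<open>positive_one_minus_small\<close>) and hence from the completeness of
  \<open>\<ell>\<^sup>2(\<int>)\<close>. Density of the Lipschitz elements is clear: every power of the shift is one.
\<close>

section \<open>Expansions in the standard basis and completeness\<close>

lemma norm_ell2_has_sum: "((\<lambda>j. (cmod (coord v j))\<^sup>2) has_sum (norm v)\<^sup>2) UNIV"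
  using has_sum_infsum[OF coord_summable[of v]] by (simp add: norm_ell2_def infsum_nonneg)

lemma sum_coord_le_norm:
  assumes "finite F"
  shows "(\<Sum>j\<in>F. (cmod (coord v j))\<^sup>2) \<le> (norm v)\<^sup>2"
  using finite_sum_le_infsum[OF coord_summable[of v] assms] infsumI[OF norm_ell2_has_sum[of v]]
  by simp

text \<open>Vectors are built from candidate coordinates through this criterion, in the completeness proof
  as well as for adjoints.\<close>

lemma ell2_of_finite_bounds:
  fixes f :: "int \<Rightarrow> complex"
  assumes "\<And>F. finite F \<Longrightarrow> (\<Sum>j\<in>F. (cmod (f j))\<^sup>2) \<le> B\<^sup>2" and "0 \<le> B"
  obtains v where "coord v = f" "norm v \<le> B"
proof -
  have sm: "(\<lambda>j. (cmod (f j))\<^sup>2) summable_on UNIV"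
    by (rule nonneg_bdd_above_summable_on) (auto simp: bdd_above_def intro!: assms(1))
  then have c: "coord (Abs_ell2 f) = f"
    by (simp add: Abs_ell2_inverse)
  have "(norm (Abs_ell2 f))\<^sup>2 \<le> B\<^sup>2"
    by (rule has_sum_le_finite_sums[OF norm_ell2_has_sum]) (simp add: c assms(1))
  then have "norm (Abs_ell2 f) \<le> B"
    using assms(2) by (rule power2_le_imp_le)
  with c show thesis using that by blast
qed

lemma cmod_coord_le_norm: "cmod (coord v j) \<le> norm v"
  by (rule power2_le_imp_le) (use sum_coord_le_norm[of "{j}" v] in simp_all)

lemma coord_sum: "coord (sum f F) j = (\<Sum>x\<in>F. coord (f x) j)"
  by (induction F rule: infinite_finite_induct) auto

lemma bounded_linear_coord: "bounded_linear (\<lambda>v. coord v j)"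
  by (rule bounded_linear_intro[where K = 1])
    (simp_all add: cmod_coord_le_norm scaleR_conv_of_real)

lemma coord_finite_expansion:
  assumes "finite F"
  shows "coord (\<Sum>k\<in>F. a k *\<^sub>C basis_vec k) j = (if j \<in> F then a j else 0)"
proof -
  have "coord (\<Sum>k\<in>F. a k *\<^sub>C basis_vec k) j = (\<Sum>k\<in>F. if k = j then a k else 0)"
    unfolding coord_sum by (rule sum.cong) (auto simp: coord_basis_vec)
  then show ?thesis using assms by simp
qed

lemma norm_finite_expansion:
  assumes "finite F"
  shows "(norm (\<Sum>k\<in>F. a k *\<^sub>C basis_vec k))\<^sup>2 = (\<Sum>k\<in>F. (cmod (a k))\<^sup>2)"
proof -
  have "((\<lambda>k. (cmod (a k))\<^sup>2) has_sum (\<Sum>k\<in>F. (cmod (a k))\<^sup>2)) F"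
    using assms by simp
  also have "?this \<longleftrightarrow> ((\<lambda>j. (cmod (coord (\<Sum>k\<in>F. a k *\<^sub>C basis_vec k) j))\<^sup>2)
      has_sum (\<Sum>k\<in>F. (cmod (a k))\<^sup>2)) UNIV"
    by (rule has_sum_cong_neutral) (auto simp: coord_finite_expansion assms)
  finally show ?thesis
    using norm_ell2_has_sum has_sum_unique by blast
qed

lemma norm_basis_vec: "norm (basis_vec j) = 1"
proof -
  have "(\<Sum>k\<in>{j}. 1 *\<^sub>C basis_vec k) = basis_vec j"
    by (rule ell2_eqI) simp
  then show ?thesis
    using norm_finite_expansion[of "{j}" "\<lambda>_. 1"] using norm_ge_zero[of "basis_vec j"] by (simp add: power2_eq_1_iff del: norm_ge_zero)
qed

text \<open>By Pythagoras, the squared distance from \<open>v\<close> to its truncation to \<open>F\<close> is the tail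
  \<open>\<parallel>v\<parallel>\<^sup>2 - (\<Sum>k\<in>F. \<bar>v\<^sub>k\<bar>\<^sup>2)\<close>, which tends to zero.\<close>

lemma basis_expansion_has_sum: "((\<lambda>k. coord v k *\<^sub>C basis_vec k) has_sum v) UNIV"
proof -
  let ?S = "\<lambda>F. \<Sum>k\<in>F. coord v k *\<^sub>C basis_vec k"
  have pyth: "(norm (?S F - v))\<^sup>2 = (norm v)\<^sup>2 - (\<Sum>k\<in>F. (cmod (coord v k))\<^sup>2)" if F: "finite F" for F
  proof -
    have "((\<lambda>j. (cmod (coord v j))\<^sup>2) has_sum ((norm v)\<^sup>2 - (\<Sum>k\<in>F. (cmod (coord v k))\<^sup>2))) (UNIV - F)"
      by (rule has_sum_Diff[OF norm_ell2_has_sum]) (use F in auto)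
    also have "?this \<longleftrightarrow> ((\<lambda>j. (cmod (coord (?S F - v) j))\<^sup>2) has_sum
        ((norm v)\<^sup>2 - (\<Sum>k\<in>F. (cmod (coord v k))\<^sup>2))) UNIV"
      by (rule has_sum_cong_neutral) (auto simp: coord_finite_expansion F)
    finally show ?thesis
      using norm_ell2_has_sum has_sum_unique by blast
  qed
  have "((\<lambda>F. (norm v)\<^sup>2 - (\<Sum>k\<in>F. (cmod (coord v k))\<^sup>2)) \<longlongrightarrow> (norm v)\<^sup>2 - (norm v)\<^sup>2)
      (finite_subsets_at_top UNIV)"
    by (intro tendsto_diff tendsto_const norm_ell2_has_sum[unfolded has_sum_def])
  then have "((\<lambda>F. sqrt ((norm v)\<^sup>2 - (\<Sum>k\<in>F. (cmod (coord v k))\<^sup>2))) \<longlongrightarrow> 0)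
      (finite_subsets_at_top UNIV)"
    using tendsto_real_sqrt by fastforce
  moreover have "\<forall>\<^sub>F F in finite_subsets_at_top UNIV.
      sqrt ((norm v)\<^sup>2 - (\<Sum>k\<in>F. (cmod (coord v k))\<^sup>2)) = norm (?S F - v)"
    using eventually_finite_subsets_at_top_weakI
    by (rule eventually_mono[OF _ ]) (auto simp flip: pyth)
  ultimately have "((\<lambda>F. norm (?S F - v)) \<longlongrightarrow> 0) (finite_subsets_at_top UNIV)"
    by (rule Lim_transform_eventually)
  then have "((\<lambda>F. ?S F - v) \<longlongrightarrow> 0) (finite_subsets_at_top UNIV)"
    by (rule tendsto_norm_zero_cancel)
  then have "(?S \<longlongrightarrow> v) (finite_subsets_at_top UNIV)"
    by (rule LIM_zero_cancel)
  then show ?thesis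
    unfolding has_sum_def .
qed

text \<open>The limit is taken coordinatewise; the Cauchy bound passes to the limit on finite sets of coordinates,
  which puts the differences \<open>X n - f\<close> in \<open>\<ell>\<^sup>2\<close> with small norm.\<close>

instance ell2 :: banach
proof
  fix X :: "nat \<Rightarrow> ell2"
  assume C: "Cauchy X"
  have "Cauchy (\<lambda>n. coord (X n) j)" for j
    by (rule bounded_linear.Cauchy[OF bounded_linear_coord C])
  then obtain f where f: "\<And>j. (\<lambda>n. coord (X n) j) \<longlonglongrightarrow> f j"
    unfolding Cauchy_convergent_iff convergent_def by metis
  have close: "\<exists>v. coord v = (\<lambda>j. coord (X n) j - f j) \<and> norm v \<le> e"
    if M: "\<And>m. m \<ge> M \<Longrightarrow> norm (X n - X m) \<le> e" and e: "0 \<le> e" for M n e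
  proof -
    have "(\<Sum>j\<in>F. (cmod (coord (X n) j - f j))\<^sup>2) \<le> e\<^sup>2" if "finite F" for F
    proof (rule tendsto_upperbound)
      show "(\<lambda>m. \<Sum>j\<in>F. (cmod (coord (X n) j - coord (X m) j))\<^sup>2)
          \<longlonglongrightarrow> (\<Sum>j\<in>F. (cmod (coord (X n) j - f j))\<^sup>2)"
        by (intro tendsto_intros f)
      show "\<forall>\<^sub>F m in sequentially. (\<Sum>j\<in>F. (cmod (coord (X n) j - coord (X m) j))\<^sup>2) \<le> e\<^sup>2"
      proof (rule eventually_sequentiallyI)
        fix m assume "M \<le> m"
        have "(\<Sum>j\<in>F. (cmod (coord (X n) j - coord (X m) j))\<^sup>2) \<le> (norm (X n - X m))\<^sup>2"
          using sum_coord_le_norm[OF that, of "X n - X m"] by simp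
        also have "\<dots> \<le> e\<^sup>2"
          using M[OF \<open>M \<le> m\<close>] by (simp add: power_mono)
        finally show "(\<Sum>j\<in>F. (cmod (coord (X n) j - coord (X m) j))\<^sup>2) \<le> e\<^sup>2" .
      qed
    qed simp
    then show ?thesis
      using ell2_of_finite_bounds[of "\<lambda>j. coord (X n) j - f j" e] e by metis
  qed
  have tail: "\<exists>M. \<forall>m\<ge>M. \<forall>n\<ge>M. norm (X n - X m) < e" if "0 < e" for e
    using C that unfolding Cauchy_def dist_norm by meson
  \<comment> \<open>the limit itself lies in \<open>\<ell>\<^sup>2\<close>, being \<open>X M - v\<close>\<close>
  obtain M where "\<forall>m\<ge>M. norm (X M - X m) < 1"
    using tail[of 1] by auto
  then obtain v where v: "coord v = (\<lambda>j. coord (X M) j - f j)"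
    using close[of M M 1] by (metis less_imp_le zero_le_one)
  define l where "l = X M - v"
  have l: "coord l j = f j" for j
    by (simp add: l_def v)
  have "X \<longlonglongrightarrow> l"
  proof (rule LIMSEQ_I)
    fix e :: real assume "0 < e"
    then obtain M where M: "\<And>m n. m \<ge> M \<Longrightarrow> n \<ge> M \<Longrightarrow> norm (X n - X m) < e/2"
      using tail[of "e/2"] by auto
    have "norm (X n - l) < e" if "n \<ge> M" for n
    proof -
      obtain w where w: "coord w = (\<lambda>j. coord (X n) j - f j)" "norm w \<le> e/2"
        using close[of M n "e/2"] M[of _ n] \<open>n \<ge> M\<close> \<open>0 < e\<close> by (auto simp: less_imp_le)
      then have "X n - l = w"
        by (intro ell2_eqI) (simp add: l)
      then show ?thesis using w(2) \<open>0 < e\<close> by simp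
    qed
    then show "\<exists>no. \<forall>n\<ge>no. norm (X n - l) < e" by blast
  qed
  then show "convergent X" by (auto simp: convergent_def)
qed

section \<open>Matrix entries and adjoints\<close>

lemma cinner_basis_vec: "cinner (basis_vec j) v = coord v j"
proof -
  have "((\<lambda>k. cnj (coord (basis_vec j) k) * coord v k) has_sum coord v j) UNIV
      \<longleftrightarrow> ((\<lambda>k. coord v k) has_sum coord v j) {j}"
    by (rule has_sum_cong_neutral) (auto simp: coord_basis_vec)
  then show ?thesis
    unfolding cinner_def by (simp add: infsumI has_sum_finiteI)
qed

lemma entry_eq_coord: "entry T j k = coord (blinfun_apply T (basis_vec k)) j"
  by (simp add: entry_def cinner_basis_vec)

lemma cinner_eqI: "(\<And>w. cinner v w = cinner v' w) \<Longrightarrow> v = v'"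
proof (rule ell2_eqI)
  fix j
  assume "\<And>w. cinner v w = cinner v' w"
  then have "cnj (cinner v (basis_vec j)) = cnj (cinner v' (basis_vec j))" by simp
  then show "coord v j = coord v' j"
    by (simp only: cinner_commute[symmetric] cinner_basis_vec)
qed

text \<open>Rotating \<open>w\<close> by a unimodular scalar makes the complex inner product real, which reduces the
  inequality to the real one.\<close>

lemma cinner_Cauchy_Schwarz: "cmod (cinner v w) \<le> norm v * norm w"
proof (cases "cinner v w = 0")
  case False
  define c where "c = cnj (sgn (cinner v w))"
  have "cinner v (c *\<^sub>C w) = of_real (cmod (cinner v w))"
    using False complex_norm_square[of "cinner v w"]
    by (simp add: cinner_scaleC_right c_def sgn_eq field_simps power2_eq_square)
  then have "cmod (cinner v w) = inner v (c *\<^sub>C w)"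
    by (simp add: inner_ell2_def)
  also have "\<dots> \<le> norm v * norm (c *\<^sub>C w)"
    by (rule norm_cauchy_schwarz)
  also have "\<dots> = norm v * norm w"
    using False by (simp add: norm_scaleC c_def norm_sgn)
  finally show ?thesis .
qed simp

lemma bounded_linear_cinner_right: "bounded_linear (\<lambda>w. cinner v w)"
proof (rule bounded_linear_intro)
  show "norm (cinner v w) \<le> norm w * norm v" for w
    using cinner_Cauchy_Schwarz[of v w] by (simp only: mult.commute)
  show "cinner v (r *\<^sub>R w) = r *\<^sub>R cinner v w" for r w
    unfolding scaleR_ell2_def by (simp only: cinner_scaleC_right scaleR_conv_of_real)
qed (rule cinner_add_right)

lemma apply_basis_expansion:
  assumes "T \<in> bounded_ops"
  shows "((\<lambda>k. coord v k *\<^sub>C blinfun_apply T (basis_vec k)) has_sum blinfun_apply T v) UNIV"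
proof -
  have "((\<lambda>k. blinfun_apply T (coord v k *\<^sub>C basis_vec k)) has_sum blinfun_apply T v) UNIV"
    using has_sum_bounded_linear[OF blinfun.bounded_linear_right basis_expansion_has_sum[of v], of T]
    by (simp only: o_def)
  moreover have "blinfun_apply T (coord v k *\<^sub>C basis_vec k) = coord v k *\<^sub>C blinfun_apply T (basis_vec k)" for k
    using assms by (simp only: bounded_ops_def mem_Collect_eq)
  ultimately show ?thesis by (simp only:)
qed

lemma bounded_ops_eqI:
  assumes "S \<in> bounded_ops" "T \<in> bounded_ops" "\<And>j k. entry S j k = entry T j k"
  shows "S = T"
proof (rule blinfun_eqI)
  fix v
  have eq: "blinfun_apply S (basis_vec k) = blinfun_apply T (basis_vec k)" for k
    using assms(3) by (intro ell2_eqI) (simp add: entry_eq_coord)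
  show "blinfun_apply S v = blinfun_apply T v"
    by (rule has_sum_unique[OF apply_basis_expansion[OF assms(1)]])
      (simp only: eq apply_basis_expansion[OF assms(2)])
qed

text \<open>The vector \<open>u\<close> representing the functional \<open>w \<mapsto> cinner v (T w)\<close> has the coordinates
  \<open>cinner (T e\<^sub>k) v\<close>; testing against their finite truncations shows that they are square summable.\<close>

lemma adjoint_vector_exists:
  assumes T: "T \<in> bounded_ops"
  obtains u where "\<And>w. cinner u w = cinner v (blinfun_apply T w)" "norm u \<le> norm T * norm v"
proof -
  define g where "g k = cinner (blinfun_apply T (basis_vec k)) v" for k
  have g': "cinner v (blinfun_apply T (basis_vec k)) = cnj (g k)" for k
    unfolding g_def by (rule cinner_commute)
  have bd: "(\<Sum>k\<in>F. (cmod (g k))\<^sup>2) \<le> (norm T * norm v)\<^sup>2" if F: "finite F" for F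
  proof -
    define w where "w = (\<Sum>k\<in>F. g k *\<^sub>C basis_vec k)"
    define s where "s = (\<Sum>k\<in>F. (cmod (g k))\<^sup>2)"
    have s: "(norm w)\<^sup>2 = s"
      unfolding w_def s_def by (rule norm_finite_expansion[OF F])
    have lin: "linear (\<lambda>w. cinner v (blinfun_apply T w))"
      by (intro bounded_linear.linear bounded_linear_compose[OF bounded_linear_cinner_right]
          blinfun.bounded_linear_right)
    have "cinner v (blinfun_apply T w) = (\<Sum>k\<in>F. cinner v (blinfun_apply T (g k *\<^sub>C basis_vec k)))"
      unfolding w_def by (rule linear_sum[OF lin])
    also have "\<dots> = (\<Sum>k\<in>F. of_real ((cmod (g k))\<^sup>2))"
      using T by (intro sum.cong refl)
        (simp add: bounded_ops_def cinner_scaleC_right g' complex_norm_square del: of_real_power)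
    finally have "cinner v (blinfun_apply T w) = of_real s"
      by (simp add: s_def)
    then have "\<bar>s\<bar> \<le> norm v * norm (blinfun_apply T w)"
      using cinner_Cauchy_Schwarz[of v "blinfun_apply T w"] by simp
    also have "\<dots> \<le> norm v * (norm T * norm w)"
      by (intro mult_left_mono norm_blinfun) simp
    finally have "norm w * norm w \<le> (norm T * norm v) * norm w"
      using s by (simp add: power2_eq_square mult_ac)
    then have "norm w \<le> norm T * norm v"
      by (cases "norm w = 0") (simp, metis mult_le_cancel_right norm_ge_zero order_le_less)
    then show ?thesis
      using s s_def by (metis norm_ge_zero power_mono)
  qed
  then obtain u where u: "coord u = g" "norm u \<le> norm T * norm v"
    by (rule ell2_of_finite_bounds) auto
  have "cinner u w = cinner v (blinfun_apply T w)" for w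
  proof -
    have "((\<lambda>k. cinner v (coord w k *\<^sub>C blinfun_apply T (basis_vec k))) has_sum
        cinner v (blinfun_apply T w)) UNIV"
      using has_sum_bounded_linear[OF bounded_linear_cinner_right apply_basis_expansion[OF T, of w], of v]
      by (simp add: o_def)
    then show ?thesis
      unfolding cinner_def[of u] u(1)
      by (intro infsumI) (simp add: cinner_scaleC_right g' mult.commute)
  qed
  with u(2) show thesis using that by blast
qed

lemma adj_exists:
  assumes T: "T \<in> bounded_ops"
  shows "\<exists>!S. S \<in> bounded_ops \<and>
     (\<forall>v w. cinner (blinfun_apply S v) w = cinner v (blinfun_apply T w))"
proof -
  have cinner_add_left: "cinner (u + v) w = cinner u w + cinner v w" for u v w
    by (metis cinner_add_right cinner_commute complex_cnj_add)
  have cinner_scale_left: "cinner (c *\<^sub>C v) w = cnj c * cinner v w" for c v w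
    by (metis cinner_scaleC_right cinner_commute complex_cnj_mult)
  have "\<forall>v. \<exists>u. (\<forall>w. cinner u w = cinner v (blinfun_apply T w)) \<and> norm u \<le> norm v * norm T"
    by (metis adjoint_vector_exists[OF T] mult.commute)
  then obtain s where s: "\<And>v w. cinner (s v) w = cinner v (blinfun_apply T w)"
    and n: "\<And>v. norm (s v) \<le> norm v * norm T"
    by metis
  have hom: "s (c *\<^sub>C v) = c *\<^sub>C s v" for c v
    by (rule cinner_eqI) (simp add: s cinner_scale_left)
  have "bounded_linear s"
    by (rule bounded_linear_intro[OF _ _ n])
      (auto intro!: cinner_eqI simp: s cinner_add_left scaleR_ell2_def cinner_scale_left)
  then have "blinfun_apply (Blinfun s) = s"
    by (rule bounded_linear_Blinfun_apply)
  then have ex: "Blinfun s \<in> bounded_ops \<and>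
      (\<forall>v w. cinner (blinfun_apply (Blinfun s) v) w = cinner v (blinfun_apply T w))"
    by (simp add: bounded_ops_def hom s)
  show ?thesis
  proof (rule ex1I, rule ex)
    fix S assume "S \<in> bounded_ops \<and>
     (\<forall>v w. cinner (blinfun_apply S v) w = cinner v (blinfun_apply T w))"
    then show "S = Blinfun s"
      by (intro blinfun_eqI cinner_eqI) (use ex in simp)
  qed
qed

lemma
  assumes "T \<in> bounded_ops"
  shows adj_bounded_ops: "adj T \<in> bounded_ops"
    and cinner_adj: "cinner (blinfun_apply (adj T) v) w = cinner v (blinfun_apply T w)"
  using theI'[OF adj_exists[OF assms]] unfolding adj_def by auto

lemma adj_eqI:
  assumes "T \<in> bounded_ops" "S \<in> bounded_ops"
    and "\<And>v w. cinner (blinfun_apply S v) w = cinner v (blinfun_apply T w)"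
  shows "adj T = S"
  using adj_exists[OF assms(1)] adj_bounded_ops[OF assms(1)] cinner_adj[OF assms(1)] assms(2,3)
  by blast

lemma entry_adj:
  assumes "T \<in> bounded_ops"
  shows "entry (adj T) j k = cnj (entry T k j)"
  unfolding entry_def by (metis assms cinner_adj cinner_commute)

lemma adj_eqI_entry:
  assumes "T \<in> bounded_ops" "S \<in> bounded_ops" "\<And>j k. entry S j k = cnj (entry T k j)"
  shows "adj T = S"
  by (rule bounded_ops_eqI) (auto simp: assms adj_bounded_ops entry_adj)

lemma adj_adj:
  assumes "T \<in> bounded_ops"
  shows "adj (adj T) = T"
  by (rule adj_eqI_entry) (simp_all add: assms adj_bounded_ops entry_adj)

lemma norm_adj_le:
  assumes "T \<in> bounded_ops"
  shows "norm (adj T) \<le> norm T"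
proof (rule norm_blinfun_bound)
  fix v
  obtain u where u: "\<And>w. cinner u w = cinner v (blinfun_apply T w)" "norm u \<le> norm T * norm v"
    using adjoint_vector_exists[OF assms, of v] by blast
  have "blinfun_apply (adj T) v = u"
    by (rule cinner_eqI) (simp add: u(1) cinner_adj[OF assms])
  with u(2) show "norm (blinfun_apply (adj T) v) \<le> norm T * norm v" by simp
qed simp

lemma norm_adj:
  assumes "T \<in> bounded_ops"
  shows "norm (adj T) = norm T"
  using norm_adj_le[OF assms] norm_adj_le[OF adj_bounded_ops[OF assms]] adj_adj[OF assms] by simp

lemma
  shows entry_add: "entry (S + T) j k = entry S j k + entry T j k"
    and entry_minus: "entry (S - T) j k = entry S j k - entry T j k"
    and entry_scaleR: "entry (r *\<^sub>R T) j k = of_real r * entry T j k"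
    and entry_zero: "entry 0 j k = 0"
    and entry_scale_op: "entry (scale_op c T) j k = c * entry T j k"
    and entry_id: "entry id_blinfun j k = (if j = k then 1 else 0)"
  by (simp_all add: entry_eq_coord blinfun.add_left blinfun.diff_left blinfun.minus_left
      blinfun.scaleR_left scale_op_apply coord_basis_vec)

lemma
  shows bounded_ops_add: "S \<in> bounded_ops \<Longrightarrow> T \<in> bounded_ops \<Longrightarrow> S + T \<in> bounded_ops"
    and bounded_ops_minus: "S \<in> bounded_ops \<Longrightarrow> T \<in> bounded_ops \<Longrightarrow> S - T \<in> bounded_ops"
    and bounded_ops_zero: "0 \<in> bounded_ops"
    and bounded_ops_id: "id_blinfun \<in> bounded_ops"
    and bounded_ops_scale_op: "T \<in> bounded_ops \<Longrightarrow> scale_op c T \<in> bounded_ops"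
    and bounded_ops_scaleR: "T \<in> bounded_ops \<Longrightarrow> r *\<^sub>R T \<in> bounded_ops"
    and bounded_ops_compose: "S \<in> bounded_ops \<Longrightarrow> T \<in> bounded_ops \<Longrightarrow> S o\<^sub>L T \<in> bounded_ops"
  by (auto simp: bounded_ops_def blinfun.add_left blinfun.diff_left blinfun.scaleR_left
      scale_op_apply intro!: ell2_eqI simp: algebra_simps)

lemma closed_bounded_ops: "closed bounded_ops"
proof -
  have eq: "bounded_ops = (\<Inter>c. \<Inter>v. {T. blinfun_apply T (c *\<^sub>C v) = c *\<^sub>C blinfun_apply T v})"
    by (auto simp: bounded_ops_def)
  show ?thesis
    unfolding eq
    by (intro closed_INT ballI closed_Collect_eq bounded_linear.continuous_on[OF bounded_linear_scaleC]
        continuous_intros)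
qed

lemma bounded_linear_entry: "bounded_linear (\<lambda>T. entry T j k)"
  unfolding entry_eq_coord
  by (intro bounded_linear_compose[OF bounded_linear_coord] blinfun.bounded_linear_left)

lemma scale_op_eq_compose: "scale_op c T = scale_op c id_blinfun o\<^sub>L T"
  by (rule blinfun_eqI) (simp add: scale_op_apply)

lemma bounded_linear_scale_op: "bounded_linear (\<lambda>T. scale_op c T)"
  using bounded_bilinear.bounded_linear_right[OF bounded_bilinear_blinfun_compose]
  by (subst scale_op_eq_compose[abs_def]) blast

lemma norm_scale_op_le: "norm (scale_op c T) \<le> cmod c * norm T"
proof (rule norm_blinfun_bound)
  fix v
  show "norm (blinfun_apply (scale_op c T) v) \<le> cmod c * norm T * norm v"
    using mult_left_mono[OF norm_blinfun[of T v], of "cmod c"]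
    by (simp add: scale_op_apply norm_scaleC mult.assoc)
qed simp

lemma norm_scale_op: "norm (scale_op c T) = cmod c * norm T"
proof (cases "c = 0")
  case True
  then show ?thesis using norm_scale_op_le[of c T] by simp
next
  case False
  have "T = scale_op (inverse c) (scale_op c T)"
    by (intro blinfun_eqI ell2_eqI) (simp add: scale_op_apply False)
  then have "norm T \<le> inverse (cmod c) * norm (scale_op c T)"
    by (metis norm_scale_op_le norm_inverse)
  then have "cmod c * norm T \<le> norm (scale_op c T)"
    using False by (simp add: field_simps)
  then show ?thesis using norm_scale_op_le[of c T] by simp
qed

lemma
  assumes "S \<in> bounded_ops" "T \<in> bounded_ops"
  shows adj_add: "adj (S + T) = adj S + adj T"
    and adj_minus: "adj (S - T) = adj S - adj T"
  by (rule adj_eqI_entry;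
      simp add: assms entry_add entry_minus entry_adj adj_bounded_ops bounded_ops_add bounded_ops_minus)+

lemma adj_scale_op:
  assumes "T \<in> bounded_ops"
  shows "adj (scale_op c T) = scale_op (cnj c) (adj T)"
  by (rule adj_eqI_entry)
    (simp_all add: assms entry_scale_op entry_adj adj_bounded_ops bounded_ops_scale_op)

lemma adj_scaleR:
  assumes "T \<in> bounded_ops"
  shows "adj (r *\<^sub>R T) = r *\<^sub>R adj T"
  by (rule adj_eqI_entry)
    (simp_all add: assms entry_scaleR entry_adj adj_bounded_ops bounded_ops_scaleR)

lemma adj_compose:
  assumes "S \<in> bounded_ops" "T \<in> bounded_ops"
  shows "adj (S o\<^sub>L T) = adj T o\<^sub>L adj S"
  by (rule adj_eqI) (simp_all add: assms bounded_ops_compose adj_bounded_ops cinner_adj)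

lemma adj_id: "adj id_blinfun = id_blinfun"
  by (rule adj_eqI_entry) (auto simp: bounded_ops_id entry_id)

lemma continuous_on_adj: "continuous_on bounded_ops adj"
proof (rule continuous_onI)
  fix S :: op2 and e :: real
  assume "S \<in> bounded_ops" "0 < e"
  then show "\<exists>d>0. \<forall>T\<in>bounded_ops. dist T S < d \<longrightarrow> dist (adj T) (adj S) \<le> e"
    by (intro exI[of _ e]) (simp add: dist_norm norm_adj bounded_ops_minus flip: adj_minus)
qed

section \<open>States and positivity\<close>

lemma scale_op_of_real: "scale_op (of_real r) T = r *\<^sub>R T"
  by (intro blinfun_eqI ell2_eqI) (simp add: scale_op_apply blinfun.scaleR_left)

lemma complex_subspace_scaleR: "complex_subspace X \<Longrightarrow> x \<in> X \<Longrightarrow> r *\<^sub>R x \<in> X"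
  unfolding complex_subspace_def by (metis scale_op_of_real)

lemma complex_subspace_uminus: "complex_subspace X \<Longrightarrow> x \<in> X \<Longrightarrow> - x \<in> X"
  using complex_subspace_scaleR[of X x "-1"] by simp

lemma complex_subspace_add: "complex_subspace X \<Longrightarrow> x \<in> X \<Longrightarrow> y \<in> X \<Longrightarrow> x + y \<in> X"
  unfolding complex_subspace_def by blast

lemma complex_subspace_minus: "complex_subspace X \<Longrightarrow> x \<in> X \<Longrightarrow> y \<in> X \<Longrightarrow> x - y \<in> X"
  using complex_subspace_add[of X x "- y"] complex_subspace_uminus[of X y] by simp

lemma complex_subspace_imp_subspace:
  assumes "complex_subspace X"
  shows "subspace X"
proof (rule subspaceI)
  show "0 \<in> X" using assms by (simp add: complex_subspace_def)
qed (auto intro: complex_subspace_scaleR[OF assms] complex_subspace_add[OF assms])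

text \<open>A square root \<open>1 - z\<close> of \<open>1 - x\<close> has to satisfy \<open>z = (x + z\<^sup>2) / 2\<close>. The right-hand side
  is a contraction of the self-adjoint elements of norm at most \<open>1/4\<close>, so its fixed point is a
  square root that stays in the algebra.\<close>

lemma positive_one_minus_small:
  assumes A: "unital_cstar_algebra A" and x: "x \<in> A" "adj x = x" "norm x \<le> 1/4"
  shows "positive_in A (id_blinfun - x)"
proof -
  have sub: "complex_subspace A" and bo: "A \<subseteq> bounded_ops" and cl: "closed A" and one: "id_blinfun \<in> A"
    and mult: "\<And>x y. x \<in> A \<Longrightarrow> y \<in> A \<Longrightarrow> x o\<^sub>L y \<in> A"
    using A by (auto simp: unital_cstar_algebra_def)
  define S where "S = {z \<in> A. adj z = z \<and> norm z \<le> 1/4}"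
  define f where "f z = (1/2) *\<^sub>R (x + (z o\<^sub>L z))" for z :: op2
  have "closed S"
  proof -
    have "closed {z \<in> A. adj z - z = 0}"
      using bo by (intro continuous_closed_preimage_constant[OF _ cl] continuous_intros
          continuous_on_subset[OF continuous_on_adj])
    moreover have "closed {z :: op2. norm z \<le> 1/4}"
      by (intro closed_Collect_le continuous_intros)
    moreover have "S = {z \<in> A. adj z - z = 0} \<inter> {z. norm z \<le> 1/4}"
      by (auto simp: S_def)
    ultimately show ?thesis by auto
  qed
  have "f z \<in> S" if z: "z \<in> S" for z
  proof -
    have zA: "z \<in> A" "z \<in> bounded_ops" "x \<in> bounded_ops" using z bo x by (auto simp: S_def)
    have "f z \<in> A"
      unfolding f_def by (intro complex_subspace_scaleR[OF sub] complex_subspace_add[OF sub] mult x zA)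
    moreover have "adj (f z) = f z"
      using z x(2) zA unfolding f_def S_def
      by (simp add: adj_scaleR adj_add adj_compose bounded_ops_add bounded_ops_compose)
    moreover have "norm (f z) \<le> 1/4"
    proof -
      have "norm (z o\<^sub>L z) \<le> norm z * norm z" by (rule norm_blinfun_compose)
      also have "\<dots> \<le> 1/4 * (1/4)"
        using z by (intro mult_mono) (auto simp: S_def)
      finally have "norm (x + (z o\<^sub>L z)) \<le> 1/4 + 1/4 * (1/4)"
        using x(3) norm_triangle_ineq[of x "z o\<^sub>L z"] by linarith
      then show ?thesis unfolding f_def by simp
    qed
    ultimately show ?thesis by (simp add: S_def)
  qed
  moreover have "dist (f z) (f w) \<le> (1/4) * dist z w" if z: "z \<in> S" and w: "w \<in> S" for z w
  proof -
    have "f z - f w = (1/2) *\<^sub>R ((z o\<^sub>L (z - w)) + ((z - w) o\<^sub>L w))"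
      unfolding f_def by (rule blinfun_eqI)
        (simp add: blinfun.bilinear_simps algebra_simps)
    then have "norm (f z - f w) \<le> (1/2) * (norm (z o\<^sub>L (z - w)) + norm ((z - w) o\<^sub>L w))"
      using norm_triangle_ineq[of "z o\<^sub>L (z - w)" "(z - w) o\<^sub>L w"] by simp
    also have "\<dots> \<le> (1/2) * (norm z * norm (z - w) + norm (z - w) * norm w)"
      by (intro mult_left_mono add_mono norm_blinfun_compose) simp
    also have "\<dots> \<le> (1/2) * (1/4 * norm (z - w) + norm (z - w) * (1/4))"
      using z w by (intro mult_left_mono add_mono mult_right_mono) (auto simp: S_def)
    finally show ?thesis by (simp add: dist_norm)
  qed
  moreover have "0 \<in> S"
    using sub adj_scale_op[OF bounded_ops_zero, of 0]
    by (auto simp: S_def complex_subspace_def scale_op_of_real[of 0, simplified])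
  ultimately have "\<exists>!z\<in>S. f z = z"
    using \<open>closed S\<close> by (intro Banach_fix[where c = "1/4"]) (auto simp: complete_eq_closed)
  then obtain z where z: "z \<in> S" "f z = z" by blast
  have zA: "z \<in> A" "z \<in> bounded_ops" "adj z = z" using z bo by (auto simp: S_def)
  have "adj (id_blinfun - z) = id_blinfun - z"
    using zA by (simp add: adj_minus bounded_ops_id adj_id)
  moreover have "(id_blinfun - z) o\<^sub>L (id_blinfun - z) = id_blinfun - x"
  proof -
    have "2 *\<^sub>R z = x + (z o\<^sub>L z)"
      using z(2) by (metis f_def scaleR_scaleR scaleR_one mult_2 field_sum_of_halves
          times_divide_eq_right mult.right_neutral)
    then have "blinfun_apply x v = 2 *\<^sub>R blinfun_apply z v - blinfun_apply z (blinfun_apply z v)" for v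
      by (metis add_diff_cancel_right' blinfun.add_left blinfun.scaleR_left blinfun_apply_blinfun_compose)
    then show ?thesis
      by (intro blinfun_eqI) (simp add: blinfun.bilinear_simps scaleR_2)
  qed
  moreover have "id_blinfun - z \<in> A"
    by (rule complex_subspace_minus[OF sub one zA(1)])
  ultimately show ?thesis
    unfolding positive_in_def by metis
qed

lemma
  assumes "operator_system A X" "\<phi> \<in> state_space A X" "x \<in> X"
  shows state_scaleR: "\<phi> (r *\<^sub>R x) = of_real r * \<phi> x"
    and state_scale_op: "\<phi> (scale_op c x) = c * \<phi> x"
    and state_add: "y \<in> X \<Longrightarrow> \<phi> (x + y) = \<phi> x + \<phi> y"
    and state_minus: "y \<in> X \<Longrightarrow> \<phi> (x - y) = \<phi> x - \<phi> y"
proof -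
  have sc: "\<phi> (scale_op c x) = c * \<phi> x" if "x \<in> X" for c x
    using assms(2) that by (auto simp: state_space_def)
  have scR: "\<phi> (r *\<^sub>R x) = of_real r * \<phi> x" if "x \<in> X" for r x
    using sc[OF that, of "of_real r"] by (simp add: scale_op_of_real)
  have neg: "\<phi> (- x) = - \<phi> x" if "x \<in> X" for x
    using scR[OF that, of "-1"] by simp
  have add: "\<phi> (x + y) = \<phi> x + \<phi> y" if "x \<in> X" "y \<in> X" for x y
    using assms(2) that by (auto simp: state_space_def)
  show "\<phi> (r *\<^sub>R x) = of_real r * \<phi> x" "\<phi> (scale_op c x) = c * \<phi> x"
    using assms(3) scR sc by auto
  show "\<phi> (x + y) = \<phi> x + \<phi> y" if "y \<in> X" using add assms(3) that by auto
  have "- y \<in> X" if "y \<in> X"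
    using assms(1) complex_subspace_uminus[OF _ that] by (auto simp: operator_system_def)
  then show "\<phi> (x - y) = \<phi> x - \<phi> y" if "y \<in> X"
    using add[of x "- y"] neg[of y] assms(3) that by simp
qed

lemma state_one: "\<phi> \<in> state_space A X \<Longrightarrow> \<phi> id_blinfun = 1"
  by (auto simp: state_space_def)

text \<open>Scaled to norm \<open>1/4\<close>, both \<open>1 - x\<close> and \<open>1 + x\<close> are positive, so \<open>\<phi>\<close> takes a real value in
  \<open>[-1, 1]\<close> there.\<close>

lemma state_selfadjoint_bound:
  assumes os: "operator_system A X" and st: "\<phi> \<in> state_space A X" and x: "x \<in> X" "adj x = x"
  shows "cmod (\<phi> x) \<le> 4 * norm x"
proof (cases "x = 0")
  case True
  then show ?thesis using state_scaleR[OF os st x(1), of 0] by simp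
next
  case False
  have sub: "complex_subspace X" and one: "id_blinfun \<in> X" and A: "unital_cstar_algebra A"
    and XA: "X \<subseteq> A"
    using os by (auto simp: operator_system_def)
  have xb: "x \<in> bounded_ops" using A XA x by (auto simp: unital_cstar_algebra_def)
  define y where "y = (1 / (4 * norm x)) *\<^sub>R x"
  have y: "y \<in> X" "adj y = y" "norm y = 1/4"
    using False by (auto simp: y_def complex_subspace_scaleR[OF sub x(1)] adj_scaleR[OF xb] x(2))
  have ny: "- y \<in> X" "adj (- y) = - y" "norm (- y) = 1/4"
    using y adj_scaleR[of y "-1"] XA A
    by (auto simp: complex_subspace_uminus[OF sub] unital_cstar_algebra_def)
  have pos: "\<phi> (id_blinfun - u) \<in> \<real>\<^sub>\<ge>\<^sub>0" if u: "u \<in> X" "adj u = u" "norm u = 1/4" for u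
  proof -
    have "positive_in A (id_blinfun - u)"
      using u XA by (intro positive_one_minus_small[OF A]) auto
    then show ?thesis
      using st complex_subspace_minus[OF sub one u(1)] by (auto simp: state_space_def)
  qed
  have "1 - \<phi> y \<in> \<real>\<^sub>\<ge>\<^sub>0" "1 + \<phi> y \<in> \<real>\<^sub>\<ge>\<^sub>0"
    using pos[OF y] pos[OF ny] state_minus[OF os st one y(1)] state_add[OF os st one y(1)]
      state_one[OF st] by auto
  then have "cmod (\<phi> y) \<le> 1"
    by (auto simp: complex_nonneg_Reals_iff cmod_eq_Re)
  moreover have "\<phi> x = of_real (4 * norm x) * \<phi> y"
    using False state_scaleR[OF os st x(1), of "1 / (4 * norm x)"] by (simp add: y_def)
  ultimately show ?thesis
    using False by (simp add: norm_mult)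
qed

text \<open>The optimal constant is \<open>1\<close>, but a crude one is enough for comparing topologies.\<close>

lemma state_bound:
  assumes os: "operator_system A X" and st: "\<phi> \<in> state_space A X" and x: "x \<in> X"
  shows "cmod (\<phi> x) \<le> 8 * norm x"
proof -
  have sub: "complex_subspace X" and ad: "adj x \<in> X" and xb: "x \<in> bounded_ops"
    using os x by (auto simp: operator_system_def unital_cstar_algebra_def)
  \<comment> \<open>the real and imaginary parts of \<open>x\<close>\<close>
  define a where "a = (1/2) *\<^sub>R (x + adj x)"
  define b where "b = scale_op (- \<i> / 2) (x - adj x)"
  have ab: "a \<in> X" "b \<in> X"
    using sub complex_subspace_add[OF sub x ad] complex_subspace_minus[OF sub x ad]
    by (auto simp: a_def b_def complex_subspace_scaleR complex_subspace_def)
  have adb: "adj x \<in> bounded_ops" by (rule adj_bounded_ops[OF xb])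
  have sa: "adj a = a" "adj b = b"
    using xb adb unfolding a_def b_def
    by (auto simp: entry_scaleR entry_scale_op entry_add entry_minus entry_adj algebra_simps
        intro!: adj_eqI_entry bounded_ops_add bounded_ops_minus bounded_ops_scaleR bounded_ops_scale_op)
  have "norm (x + adj x) \<le> 2 * norm x" "norm (x - adj x) \<le> 2 * norm x"
    using norm_triangle_ineq[of x "adj x"] norm_triangle_ineq4[of x "adj x"] norm_adj[OF xb] by auto
  then have n: "norm a \<le> norm x" "norm b \<le> norm x"
    by (auto simp: a_def b_def norm_scale_op norm_divide)
  have "scale_op \<i> b = (1/2) *\<^sub>R (x - adj x)"
    unfolding b_def by (intro blinfun_eqI ell2_eqI)
      (simp add: scale_op_apply blinfun.bilinear_simps algebra_simps)
  then have "x = a + scale_op \<i> b"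
    by (simp add: a_def flip: scaleR_add_right)
  moreover have "scale_op \<i> b \<in> X" using ab sub by (auto simp: complex_subspace_def)
  ultimately have "\<phi> x = \<phi> a + \<i> * \<phi> b"
    using state_add[OF os st ab(1)] state_scale_op[OF os st ab(2)] by metis
  then have "cmod (\<phi> x) \<le> cmod (\<phi> a) + cmod (\<phi> b)"
    using norm_triangle_ineq[of "\<phi> a" "\<i> * \<phi> b"] by (simp add: norm_mult)
  also have "\<dots> \<le> 4 * norm a + 4 * norm b"
    by (intro add_mono state_selfadjoint_bound[OF os st] ab sa)
  finally show ?thesis using n by simp
qed

section \<open>Total boundedness and the topology of the Monge-Kantorovich metric\<close>

text \<open>The \<open>1\<close> added to \<open>L x\<close> allows rescaling \<open>x\<close> into the unit ball even if \<open>L x = 0\<close>.\<close>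

lemma mk_dist_less_imp:
  assumes os: "operator_system A X" and sl: "slip_norm X L"
    and st: "\<phi> \<in> state_space A X" "\<psi> \<in> state_space A X" and e: "0 < e"
    and d: "mk_dist X L \<phi> \<psi> < ennreal e" and x: "x \<in> X"
  shows "cmod (\<phi> x - \<psi> x) < e * (L x + 1)"
proof -
  have L: "0 \<le> L x" using sl x by (simp add: slip_norm_def)
  define y where "y = (1 / (L x + 1)) *\<^sub>R x"
  have sub: "complex_subspace X" using os by (simp add: operator_system_def)
  have y: "y \<in> X" by (simp add: y_def complex_subspace_scaleR[OF sub x])
  have "L y = cmod (of_real (1 / (L x + 1))) * L x"
    using sl x unfolding y_def slip_norm_def by (metis scale_op_of_real)
  also have "\<dots> \<le> 1" unfolding norm_of_real using L by (simp add: field_simps)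
  finally have "ennreal (cmod (\<phi> y - \<psi> y)) \<le> mk_dist X L \<phi> \<psi>"
    unfolding mk_dist_def using y by (intro SUP_upper) auto
  then have "ennreal (cmod (\<phi> y - \<psi> y)) < ennreal e" using d by (rule le_less_trans)
  then have lt: "cmod (\<phi> y - \<psi> y) < e" using e by (simp add: ennreal_less_iff)
  have "\<phi> y - \<psi> y = of_real (1 / (L x + 1)) * (\<phi> x - \<psi> x)"
    unfolding y_def state_scaleR[OF os st(1) x] state_scaleR[OF os st(2) x]
    by (simp only: right_diff_distrib)
  then have "cmod (\<phi> y - \<psi> y) = cmod (\<phi> x - \<psi> x) / (L x + 1)"
    using L by (simp only: norm_mult norm_of_real) simp
  then show ?thesis using lt L by (simp add: pos_divide_less_eq)
qed

text \<open>Every slip-norm makes the metric topology at least as fine as the weak-\<open>*\<close> topology: evaluation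
  at a fixed element is Lipschitz for the Monge-Kantorovich metric.\<close>

lemma weak_star_open_imp_mk_open:
  assumes os: "operator_system A X" and sl: "slip_norm X L"
    and W: "openin (weak_star_topology A X) W"
  shows "openin (mk_topology A X L) W"
  unfolding openin_mk_topology
proof (intro conjI ballI)
  obtain V where V: "openin (product_topology (\<lambda>_. euclidean) X) V" "W = V \<inter> state_space A X"
    using W unfolding weak_star_topology_def openin_subtopology by blast
  show "W \<subseteq> state_space A X" using V by blast
  fix \<phi> assume \<phi>: "\<phi> \<in> W"
  then obtain U where U: "finite {x \<in> X. U x \<noteq> UNIV}" "\<And>x. x \<in> X \<Longrightarrow> open (U x)"
    "\<phi> \<in> Pi\<^sub>E X U" "Pi\<^sub>E X U \<subseteq> V"
    using V by (auto simp: openin_product_topology_alt)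
  define J where "J = {x \<in> X. U x \<noteq> UNIV}"
  have "\<exists>d>0. ball (\<phi> x) d \<subseteq> U x" if "x \<in> X" for x
    using U(2)[OF that] PiE_mem[OF U(3) that] open_contains_ball by blast
  then obtain d where d: "\<And>x. x \<in> X \<Longrightarrow> d x > 0" "\<And>x. x \<in> X \<Longrightarrow> ball (\<phi> x) (d x) \<subseteq> U x"
    by metis
  have L: "0 \<le> L x" if "x \<in> X" for x using sl that by (simp add: slip_norm_def)
  define e where "e = Min (insert 1 ((\<lambda>x. d x / (L x + 1)) ` J))"
  have fin: "finite (insert 1 ((\<lambda>x. d x / (L x + 1)) ` J))" using U(1) by (simp add: J_def)
  have e: "e > 0"
    unfolding e_def using fin d(1) L by (subst Min_gr_iff) (auto simp: J_def intro!: divide_pos_pos add_nonneg_pos)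
  have "\<psi> \<in> W" if \<psi>: "\<psi> \<in> state_space A X" and less: "mk_dist X L \<phi> \<psi> < ennreal e" for \<psi>
  proof -
    have "\<psi> x \<in> U x" if x: "x \<in> X" for x
    proof (cases "x \<in> J")
      case True
      have "cmod (\<phi> x - \<psi> x) < e * (L x + 1)"
        using mk_dist_less_imp[OF os sl _ \<psi> e less x] \<phi> V by blast
      also have "\<dots> \<le> d x / (L x + 1) * (L x + 1)"
        using True fin L[OF x] by (intro mult_right_mono) (auto simp: e_def intro!: Min_le)
      also have "\<dots> = d x" using L[OF x] by simp
      finally show ?thesis using d(2)[OF x] by (auto simp: dist_norm)
    qed (use x in \<open>simp add: J_def\<close>)
    moreover have "\<psi> \<in> extensional X" using \<psi> by (simp add: state_space_def)
    ultimately have "\<psi> \<in> Pi\<^sub>E X U" by (simp add: PiE_iff)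
    then show ?thesis
      using U(4) V(2) \<psi> by blast
  qed
  then show "\<exists>\<epsilon>>0. \<forall>\<psi>\<in>state_space A X. mk_dist X L \<phi> \<psi> < ennreal \<epsilon> \<longrightarrow> \<psi> \<in> W"
    using e by blast
qed

text \<open>A finite net for the Lipschitz ball modulo scalars bounds the metric: scalars cancel in
  \<open>\<phi> - \<psi>\<close>, and the approximation errors are controlled by boundedness of states, so that closeness
  at the finitely many net points makes \<open>\<phi>\<close> and \<open>\<psi>\<close> uniformly close on the ball.\<close>

lemma mk_open_imp_weak_star_open:
  assumes os: "operator_system A X"
    and net: "\<And>e. e > 0 \<Longrightarrow> \<exists>F. finite F \<and> F \<subseteq> X \<and>
      (\<forall>x\<in>X. L x \<le> 1 \<longrightarrow> (\<exists>y\<in>F. \<exists>c. norm (x - (y + scale_op c id_blinfun)) \<le> e))"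
    and W: "openin (mk_topology A X L) W"
  shows "openin (weak_star_topology A X) W"
proof (subst openin_subopen, intro ballI)
  fix \<phi> assume \<phi>: "\<phi> \<in> W"
  have WS: "W \<subseteq> state_space A X" using W openin_mk_topology by blast
  obtain e where e: "e > 0"
    and eW: "\<And>\<psi>. \<psi> \<in> state_space A X \<Longrightarrow> mk_dist X L \<phi> \<psi> < ennreal e \<Longrightarrow> \<psi> \<in> W"
    using W \<phi> unfolding openin_mk_topology by blast
  have sub: "complex_subspace X" and one: "id_blinfun \<in> X" using os by (auto simp: operator_system_def)
  \<comment> \<open>since \<open>\<parallel>\<phi>\<parallel>\<close> and \<open>\<parallel>\<psi>\<parallel>\<close> are at most \<open>8\<close>, the error \<open>e/64\<close> costs at most \<open>e/8\<close> for each of them\<close>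
  obtain F where F: "finite F" "F \<subseteq> X"
    and Fnet: "\<And>x. x \<in> X \<Longrightarrow> L x \<le> 1 \<Longrightarrow> \<exists>y\<in>F. \<exists>c. norm (x - (y + scale_op c id_blinfun)) \<le> e / 64"
    using net[of "e / 64"] e by auto
  define B where "B = Pi\<^sub>E X (\<lambda>x. if x \<in> F then ball (\<phi> x) (e / 4) else UNIV)"
  have "openin (product_topology (\<lambda>_. euclidean) X) B"
    unfolding B_def using F(1)
    by (intro product_topology_basis) (auto intro: finite_subset[OF _ F(1)])
  then have "openin (weak_star_topology A X) (B \<inter> state_space A X)"
    unfolding weak_star_topology_def openin_subtopology by blast
  moreover have "\<phi> \<in> B \<inter> state_space A X"
    using \<phi> WS e by (auto simp: B_def PiE_iff state_space_def)
  moreover have "\<psi> \<in> W" if \<psi>: "\<psi> \<in> B" "\<psi> \<in> state_space A X" for \<psi>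
  proof (rule eW[OF \<psi>(2)])
    have \<phi>': "\<phi> \<in> state_space A X" using \<phi> WS by blast
    have "cmod (\<phi> x - \<psi> x) \<le> e / 2" if x: "x \<in> X" "L x \<le> 1" for x
    proof -
      obtain y c where y: "y \<in> F" and n: "norm (x - (y + scale_op c id_blinfun)) \<le> e / 64"
        using Fnet[OF x] by blast
      have yX: "y \<in> X" using y F by blast
      define s where "s = x - (y + scale_op c id_blinfun)"
      have cX: "scale_op c id_blinfun \<in> X" using sub one by (simp add: complex_subspace_def)
      have ycX: "y + scale_op c id_blinfun \<in> X" by (rule complex_subspace_add[OF sub yX cX])
      have sX: "s \<in> X" unfolding s_def by (rule complex_subspace_minus[OF sub x(1) ycX])
      have dec: "\<omega> x = \<omega> s + \<omega> y + c" if "\<omega> \<in> state_space A X" for \<omega>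
      proof -
        have "x = s + (y + scale_op c id_blinfun)" by (simp add: s_def)
        then have "\<omega> x = \<omega> s + \<omega> (y + scale_op c id_blinfun)"
          using state_add[OF os that sX ycX] by metis
        then show ?thesis
          by (simp add: state_add[OF os that yX cX] state_scale_op[OF os that one] state_one[OF that])
      qed
      have "\<phi> x - \<psi> x = \<phi> s - \<psi> s + (\<phi> y - \<psi> y)"
        using dec[OF \<phi>'] dec[OF \<psi>(2)] by simp
      then have "cmod (\<phi> x - \<psi> x) \<le> cmod (\<phi> s) + cmod (\<psi> s) + cmod (\<phi> y - \<psi> y)"
        using norm_triangle_ineq[of "\<phi> s - \<psi> s" "\<phi> y - \<psi> y"] norm_triangle_ineq4[of "\<phi> s" "\<psi> s"]
        by simp
      moreover have "cmod (\<phi> s) \<le> e / 8" "cmod (\<psi> s) \<le> e / 8"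
        using state_bound[OF os \<phi>' sX] state_bound[OF os \<psi>(2) sX] n by (auto simp: s_def)
      moreover have "cmod (\<phi> y - \<psi> y) < e / 4"
        using PiE_mem[OF \<psi>(1)[unfolded B_def] yX] y by (simp add: dist_norm)
      ultimately show ?thesis by simp
    qed
    then have "mk_dist X L \<phi> \<psi> \<le> ennreal (e / 2)"
      unfolding mk_dist_def by (intro SUP_least ennreal_leI) auto
    also have "\<dots> < ennreal e" using e by (simp add: ennreal_less_iff)
    finally show "mk_dist X L \<phi> \<psi> < ennreal e" .
  qed
  ultimately show "\<exists>T. openin (weak_star_topology A X) T \<and> \<phi> \<in> T \<and> T \<subseteq> W"
    by blast
qed

lemma compact_quantum_metric_spaceI:
  assumes "operator_system A X" "slip_norm X L"
    and "\<And>e. e > 0 \<Longrightarrow> \<exists>F. finite F \<and> F \<subseteq> X \<and>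
      (\<forall>x\<in>X. L x \<le> 1 \<longrightarrow> (\<exists>y\<in>F. \<exists>c. norm (x - (y + scale_op c id_blinfun)) \<le> e))"
  shows "compact_quantum_metric_space A X L"
  unfolding compact_quantum_metric_space_def topology_eq
  using assms weak_star_open_imp_mk_open mk_open_imp_weak_star_open by blast

section \<open>The circle algebra as the closure of the Laurent polynomials\<close>

definition shift :: "int \<Rightarrow> op2" where
  "shift n = Blinfun (\<lambda>v. Abs_ell2 (\<lambda>j. coord v (j - n)))"

lemma coord_shift_apply: "coord (blinfun_apply (shift n) v) j = coord v (j - n)"
proof -
  define g where "g v = Abs_ell2 (\<lambda>j. coord v (j - n))" for v
  have bij: "bij_betw (\<lambda>j :: int. j - n) UNIV UNIV"
    by (rule bij_betwI[where g = "\<lambda>j. j + n"]) auto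
  have c: "coord (g v) j = coord v (j - n)" for v j
    using coord_summable[of v] summable_on_reindex_bij_betw[OF bij, of "\<lambda>j. (cmod (coord v j))\<^sup>2"]
    unfolding g_def by (subst Abs_ell2_inverse) auto
  have "norm (g v) = norm v" for v
    using infsum_reindex_bij_betw[OF bij, of "\<lambda>j. (cmod (coord v j))\<^sup>2"]
    by (simp add: norm_ell2_def c)
  then have "bounded_linear g"
    by (intro bounded_linear_intro[where K = 1]) (auto intro!: ell2_eqI simp: c)
  moreover have "shift n = Blinfun g"
    by (simp add: shift_def g_def[abs_def])
  ultimately show ?thesis
    by (simp add: bounded_linear_Blinfun_apply c)
qed

lemma shift_bounded_ops: "shift n \<in> bounded_ops"
  by (auto simp: bounded_ops_def coord_shift_apply intro!: ell2_eqI)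

lemma entry_shift: "entry (shift n) j k = (if j = k + n then 1 else 0)"
  by (auto simp: entry_eq_coord coord_shift_apply coord_basis_vec)

lemma shift_compose: "shift m o\<^sub>L shift n = shift (m + n)"
  by (intro blinfun_eqI ell2_eqI) (simp add: coord_shift_apply algebra_simps)

lemma shift_0: "shift 0 = id_blinfun"
  by (intro blinfun_eqI ell2_eqI) (simp add: coord_shift_apply)

lemma shift_1: "shift 1 = bilateral_shift"
  by (intro blinfun_eqI ell2_eqI) (simp add: coord_shift_apply coord_bilateral_shift)

lemma adj_shift: "adj (shift n) = shift (- n)"
  by (rule adj_eqI_entry) (auto simp: shift_bounded_ops entry_shift)

lemma norm_shift_le: "norm (shift n) \<le> 1"
proof (rule norm_blinfun_bound)
  fix v
  have "bij_betw (\<lambda>j :: int. j - n) UNIV UNIV"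
    by (rule bij_betwI[where g = "\<lambda>j. j + n"]) auto
  from infsum_reindex_bij_betw[OF this, of "\<lambda>j. (cmod (coord v j))\<^sup>2"]
  show "norm (blinfun_apply (shift n) v) \<le> 1 * norm v"
    by (simp add: norm_ell2_def coord_shift_apply)
qed simp

text \<open>The span is a real one, but the monomials carry complex coefficients, so it is a complex subspace.\<close>

definition laurent_polys :: "op2 set" where
  "laurent_polys = span {scale_op c (shift n) | c n. True}"

lemma scale_op_scale_op: "scale_op c (scale_op d T) = scale_op (c * d) T"
  by (intro blinfun_eqI ell2_eqI) (simp add: scale_op_apply)

lemma scale_op_one: "scale_op 1 T = T"
  by (intro blinfun_eqI ell2_eqI) (simp add: scale_op_apply)

lemma monomial_in_laurent_polys: "scale_op c (shift n) \<in> laurent_polys"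
  unfolding laurent_polys_def by (rule span_base) blast

lemma shift_in_laurent_polys: "shift n \<in> laurent_polys"
  using monomial_in_laurent_polys[of 1] by (simp add: scale_op_one)

lemma subspace_bounded_ops: "subspace bounded_ops"
  by (simp add: subspace_def bounded_ops_zero bounded_ops_add bounded_ops_scaleR)

lemma laurent_polys_bounded_ops: "laurent_polys \<subseteq> bounded_ops"
  unfolding laurent_polys_def
  by (rule span_minimal[OF _ subspace_bounded_ops]) (auto simp: bounded_ops_scale_op shift_bounded_ops)

lemma laurent_polys_induct_linear:
  assumes "linear f" "\<And>c n. f (scale_op c (shift n)) \<in> S" "subspace S" "x \<in> laurent_polys"
  shows "f x \<in> S"
proof -
  have "laurent_polys \<subseteq> f -` S"
    unfolding laurent_polys_def
    by (rule span_minimal) (use assms in \<open>auto intro: linear_subspace_vimage\<close>)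
  then show ?thesis using assms(4) by blast
qed

lemma subspace_laurent_polys: "subspace laurent_polys"
  by (simp add: laurent_polys_def)

lemma laurent_polys_scale_op: "x \<in> laurent_polys \<Longrightarrow> scale_op c x \<in> laurent_polys"
  by (rule laurent_polys_induct_linear[OF bounded_linear.linear[OF bounded_linear_scale_op]])
    (auto simp: scale_op_scale_op monomial_in_laurent_polys subspace_laurent_polys)

lemma laurent_polys_compose:
  assumes "x \<in> laurent_polys" "y \<in> laurent_polys"
  shows "x o\<^sub>L y \<in> laurent_polys"
proof (rule laurent_polys_induct_linear[OF _ _ subspace_laurent_polys assms(1)])
  show "linear (\<lambda>x. x o\<^sub>L y)"
    by (intro bounded_linear.linear bounded_bilinear.bounded_linear_left[OF bounded_bilinear_blinfun_compose])
  fix c m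
  show "scale_op c (shift m) o\<^sub>L y \<in> laurent_polys"
  proof (rule laurent_polys_induct_linear[OF _ _ subspace_laurent_polys assms(2)])
    show "linear (\<lambda>y. scale_op c (shift m) o\<^sub>L y)"
      by (intro bounded_linear.linear bounded_bilinear.bounded_linear_right[OF bounded_bilinear_blinfun_compose])
    fix d n
    have "scale_op c (shift m) o\<^sub>L scale_op d (shift n) = scale_op (c * d) (shift (m + n))"
      by (intro blinfun_eqI ell2_eqI) (simp add: scale_op_apply coord_shift_apply algebra_simps)
    then show "scale_op c (shift m) o\<^sub>L scale_op d (shift n) \<in> laurent_polys"
      by (simp add: monomial_in_laurent_polys)
  qed
qed

lemma laurent_polys_adj:
  assumes "x \<in> laurent_polys"
  shows "adj x \<in> laurent_polys"
proof -
  have "subspace {x \<in> bounded_ops. adj x \<in> laurent_polys}"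
    using subspace_laurent_polys adj_scaleR[OF bounded_ops_zero, of 0]
    by (auto simp: subspace_def bounded_ops_zero bounded_ops_add bounded_ops_scaleR adj_add adj_scaleR)
  then have "laurent_polys \<subseteq> {x \<in> bounded_ops. adj x \<in> laurent_polys}"
    by (subst (1) laurent_polys_def, intro span_minimal)
      (auto simp: bounded_ops_scale_op shift_bounded_ops adj_scale_op adj_shift monomial_in_laurent_polys)
  with assms show ?thesis by blast
qed

text \<open>A separately continuous operation extends from a set to its closure one variable at a time.\<close>

lemma closure_closed_under:
  fixes f :: "'a :: topological_space \<Rightarrow> 'a \<Rightarrow> 'a"
  assumes "\<And>x. continuous_on UNIV (f x)" "\<And>y. continuous_on UNIV (\<lambda>x. f x y)"
    and P: "\<And>x y. x \<in> P \<Longrightarrow> y \<in> P \<Longrightarrow> f x y \<in> P"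
    and x: "x \<in> closure P" and y: "y \<in> closure P"
  shows "f x y \<in> closure P"
proof -
  have left: "f x y \<in> closure P" if "y \<in> P" for y
    using image_closure_subset[OF continuous_on_subset[OF assms(2)] closed_closure, of P y P]
      P[OF _ that] closure_subset x by blast
  show ?thesis
    using image_closure_subset[OF continuous_on_subset[OF assms(1)] closed_closure, of P x P] left y
    by blast
qed

text \<open>This is what makes \<open>C_circle\<close> tractable: \<open>closure laurent_polys\<close> is itself one of the
  algebras over which the defining intersection runs.\<close>

lemma unital_cstar_algebra_closure_laurent_polys: "unital_cstar_algebra (closure laurent_polys)"
  unfolding unital_cstar_algebra_def complex_subspace_def
proof (intro conjI ballI allI)
  show bo: "closure laurent_polys \<subseteq> bounded_ops"
    by (intro closure_minimal laurent_polys_bounded_ops closed_bounded_ops)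
  show "0 \<in> closure laurent_polys"
    using subspace_laurent_polys closure_subset subspace_0 by blast
  show "id_blinfun \<in> closure laurent_polys"
    using shift_in_laurent_polys[of 0] closure_subset by (auto simp: shift_0)
  show "closed (closure laurent_polys)" by simp
  fix x assume x: "x \<in> closure laurent_polys"
  show "adj x \<in> closure laurent_polys"
    using image_closure_subset[OF continuous_on_subset[OF continuous_on_adj bo] closed_closure,
        of laurent_polys] laurent_polys_adj closure_subset x by blast
  show "scale_op c x \<in> closure laurent_polys" for c
  proof -
    have "scale_op c ` closure laurent_polys \<subseteq> closure laurent_polys"
      by (intro image_closure_subset bounded_linear.continuous_on[OF bounded_linear_scale_op]
          continuous_on_id closed_closure)
        (use laurent_polys_scale_op closure_subset in blast)
    with x show ?thesis by blast
  qed
  fix y assume y: "y \<in> closure laurent_polys"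
  show "x + y \<in> closure laurent_polys"
    by (rule closure_closed_under[where f = "(+)", OF _ _ _ x y])
      (auto intro!: continuous_intros subspace_add[OF subspace_laurent_polys])
  show "x o\<^sub>L y \<in> closure laurent_polys"
    by (rule closure_closed_under[where f = "(o\<^sub>L)", OF _ _ _ x y])
      (auto intro!: laurent_polys_compose bounded_bilinear.continuous_on[OF bounded_bilinear_blinfun_compose]
        continuous_intros)
qed

lemma shift_in_unital_cstar_algebra:
  assumes A: "unital_cstar_algebra A" and "bilateral_shift \<in> A"
  shows "shift n \<in> A"
proof (induction n rule: int_induct[where k = 0])
  case base
  then show ?case using A by (simp add: shift_0 unital_cstar_algebra_def)
next
  have 1: "shift 1 \<in> A" using assms(2) by (simp add: shift_1)
  then have 2: "shift (- 1) \<in> A" using A by (auto simp: unital_cstar_algebra_def simp flip: adj_shift)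
  have m: "shift i o\<^sub>L shift j \<in> A" if "shift i \<in> A" "shift j \<in> A" for i j
    using A that by (auto simp: unital_cstar_algebra_def)
  show "shift (i + 1) \<in> A" if "shift i \<in> A" for i
    using m[OF that 1] by (simp add: shift_compose)
  show "shift (i - 1) \<in> A" if "shift i \<in> A" for i
    using m[OF that 2] by (simp add: shift_compose)
qed

lemma C_circle_eq_closure: "C_circle = closure laurent_polys"
proof
  show "C_circle \<subseteq> closure laurent_polys"
    using unital_cstar_algebra_closure_laurent_polys shift_in_laurent_polys[of 1] closure_subset
    unfolding C_circle_def cstar_generated_def shift_1 by blast
next
  have "closure laurent_polys \<subseteq> A" if A: "unital_cstar_algebra A" "bilateral_shift \<in> A" for A
  proof (rule closure_minimal)
    have sub: "complex_subspace A" using A by (simp add: unital_cstar_algebra_def)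
    then have "subspace A" by (rule complex_subspace_imp_subspace)
    then show "laurent_polys \<subseteq> A"
      unfolding laurent_polys_def
      by (intro span_minimal) (use sub shift_in_unital_cstar_algebra[OF A] in \<open>auto simp: complex_subspace_def\<close>)
    show "closed A" using A by (simp add: unital_cstar_algebra_def)
  qed
  then show "closure laurent_polys \<subseteq> C_circle"
    unfolding C_circle_def cstar_generated_def by blast
qed

lemma unital_cstar_algebra_C_circle: "unital_cstar_algebra C_circle"
  unfolding C_circle_eq_closure by (rule unital_cstar_algebra_closure_laurent_polys)

lemma C_circle_bounded_ops: "T \<in> C_circle \<Longrightarrow> T \<in> bounded_ops"
  using unital_cstar_algebra_C_circle by (auto simp: unital_cstar_algebra_def)

text \<open>Constancy along a diagonal is a closed linear condition, so it suffices to check monomials.\<close>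

lemma entry_C_circle:
  assumes "T \<in> C_circle"
  shows "entry T j k = entry T (j - k) 0"
proof -
  have bl: "bounded_linear (\<lambda>T. entry T j k - entry T (j - k) 0)"
    by (intro bounded_linear_sub bounded_linear_entry)
  have "laurent_polys \<subseteq> {T. entry T j k - entry T (j - k) 0 = 0}"
    unfolding laurent_polys_def
  proof (rule span_minimal)
    show "subspace {T. entry T j k - entry T (j - k) 0 = 0}"
      by (rule linear_subspace_kernel[OF bounded_linear.linear[OF bl]])
  qed (auto simp: entry_scale_op entry_shift)
  then have "closure laurent_polys \<subseteq> {T. entry T j k - entry T (j - k) 0 = 0}"
    by (rule closure_minimal)
      (intro closed_Collect_eq continuous_on_const bounded_linear.continuous_on[OF bl] continuous_on_id)
  with assms show ?thesis by (auto simp: C_circle_eq_closure)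
qed

section \<open>Norm estimates from Fourier coefficients\<close>

text \<open>An operator that is constant along diagonals is the norm-convergent series of its Fourier modes
  whenever these are absolutely summable.\<close>

lemma norm_le_sum_Fourier:
  assumes T: "T \<in> bounded_ops" "\<And>j k. entry T j k = s (j - k)"
    and B: "\<And>G. finite G \<Longrightarrow> (\<Sum>n\<in>G. cmod (s n)) \<le> B"
  shows "norm T \<le> B"
proof -
  let ?f = "\<lambda>n. scale_op (s n) (shift n)"
  have nf: "norm (?f n) \<le> cmod (s n)" for n
    unfolding norm_scale_op using mult_left_mono[OF norm_shift_le[of n], of "cmod (s n)"] by simp
  have B': "(\<Sum>n\<in>G. norm (?f n)) \<le> B" if "finite G" for G
    by (rule order_trans[OF sum_mono B[OF that]]) (rule nf)
  have abs: "?f abs_summable_on UNIV"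
    by (rule nonneg_bdd_above_summable_on) (auto simp: bdd_above_def intro!: B')
  define S where "S = infsum ?f UNIV"
  have S: "(?f has_sum S) UNIV"
    unfolding S_def by (rule has_sum_infsum[OF abs_summable_summable[OF abs]])
  have "S \<in> bounded_ops"
  proof (rule Lim_in_closed_set[OF closed_bounded_ops])
    show "(sum ?f \<longlongrightarrow> S) (finite_subsets_at_top UNIV)"
      using S by (simp add: has_sum_def)
    show "\<forall>\<^sub>F F in finite_subsets_at_top UNIV. sum ?f F \<in> bounded_ops"
      by (intro always_eventually allI subspace_sum[OF subspace_bounded_ops])
        (auto simp: bounded_ops_scale_op shift_bounded_ops)
  qed simp
  have "T = S"
  proof (rule bounded_ops_eqI[OF T(1) \<open>S \<in> bounded_ops\<close>])
    fix j k
    have "((\<lambda>n. entry (?f n) j k) has_sum entry S j k) UNIV"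
      using has_sum_bounded_linear[OF bounded_linear_entry S] by (simp only: o_def)
    also have "?this \<longleftrightarrow> ((\<lambda>n. s n) has_sum entry S j k) {j - k}"
      by (rule has_sum_cong_neutral) (auto simp: entry_scale_op entry_shift)
    finally have *: "((\<lambda>n. s n) has_sum entry S j k) {j - k}" .
    have "((\<lambda>n. s n) has_sum s (j - k)) {j - k}"
      by (intro has_sum_finiteI) auto
    from has_sum_unique[OF this *] show "entry T j k = entry S j k"
      by (simp only: T(2))
  qed
  moreover have "norm S \<le> infsum (\<lambda>n. norm (?f n)) UNIV"
    unfolding S_def by (rule norm_infsum_bound[OF abs])
  moreover have "infsum (\<lambda>n. norm (?f n)) UNIV \<le> B"
    by (rule infsum_le_finite_sums[OF abs]) (rule B')
  ultimately show ?thesis by simp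
qed

lemma bounded_linear_scale_op_left: "bounded_linear (\<lambda>c. scale_op c T)"
proof (rule bounded_linear_intro)
  show "norm (scale_op c T) \<le> norm c * norm T" for c by (simp add: norm_scale_op)
  show "scale_op (c + d) T = scale_op c T + scale_op d T" for c d
    by (intro blinfun_eqI ell2_eqI) (simp add: scale_op_apply blinfun.add_left distrib_right)
  show "scale_op (r *\<^sub>R c) T = r *\<^sub>R scale_op c T" for r c
    by (intro blinfun_eqI ell2_eqI)
      (simp add: scale_op_apply blinfun.scaleR_left scaleR_conv_of_real)
qed

text \<open>Adding a frequency adds a compact disc of multiples of one shift to the set.\<close>

lemma compact_trigonometric_polys:
  assumes "finite F"
  shows "compact {\<Sum>n\<in>F. scale_op (c n) (shift n) | c. \<forall>n\<in>F. cmod (c n) \<le> 1}"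
  using assms
proof (induction F rule: finite_induct)
  case empty
  then show ?case by simp
next
  case (insert m F)
  let ?K = "\<lambda>F. {\<Sum>n\<in>F. scale_op (c n) (shift n) | c. \<forall>n\<in>F. cmod (c n) \<le> 1}"
  let ?M = "(\<lambda>c. scale_op c (shift m)) ` cball 0 1"
  have "compact ?M"
    by (intro compact_continuous_image bounded_linear.continuous_on[OF bounded_linear_scale_op_left]
        continuous_on_id compact_cball)
  then have "compact {x + y | x y. x \<in> ?M \<and> y \<in> ?K F}"
    using insert.IH by (rule compact_sums)
  also have "{x + y | x y. x \<in> ?M \<and> y \<in> ?K F} = ?K (insert m F)"
  proof (intro subset_antisym subsetI)
    fix z assume "z \<in> {x + y | x y. x \<in> ?M \<and> y \<in> ?K F}"
    then obtain a c where z: "z = scale_op a (shift m) + (\<Sum>n\<in>F. scale_op (c n) (shift n))"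
      and ac: "cmod a \<le> 1" "\<forall>n\<in>F. cmod (c n) \<le> 1" by auto
    have "(\<Sum>n\<in>F. scale_op (c n) (shift n)) = (\<Sum>n\<in>F. scale_op ((c(m := a)) n) (shift n))"
      using insert.hyps by (intro sum.cong) auto
    then have "z = (\<Sum>n\<in>insert m F. scale_op ((c(m := a)) n) (shift n))"
      unfolding z using insert.hyps by simp
    moreover have "\<forall>n\<in>insert m F. cmod ((c(m := a)) n) \<le> 1" using ac by auto
    ultimately show "z \<in> ?K (insert m F)" by blast
  next
    fix z assume "z \<in> ?K (insert m F)"
    then obtain c where z: "z = (\<Sum>n\<in>insert m F. scale_op (c n) (shift n))"
      and c: "\<forall>n\<in>insert m F. cmod (c n) \<le> 1" by blast
    have "z = scale_op (c m) (shift m) + (\<Sum>n\<in>F. scale_op (c n) (shift n))"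
      unfolding z using insert.hyps by simp
    moreover have "scale_op (c m) (shift m) \<in> ?M" using c by auto
    moreover have "(\<Sum>n\<in>F. scale_op (c n) (shift n)) \<in> ?K F" using c by blast
    ultimately show "z \<in> {x + y | x y. x \<in> ?M \<and> y \<in> ?K F}" by blast
  qed
  finally show ?case .
qed

lemma summable_inverse_squares_int: "(\<lambda>n::int. 1 / (of_int n)\<^sup>2 :: real) summable_on UNIV"
proof -
  have "summable (\<lambda>n. norm (1 / (real n)\<^sup>2))"
    using inverse_power_summable[of 2, where ?'a = real] by (simp add: field_simps)
  then have nat: "(\<lambda>n. 1 / (real n)\<^sup>2) summable_on UNIV"
    by (rule norm_summable_imp_summable_on)
  have "(\<lambda>n::int. 1 / (of_int n)\<^sup>2 :: real) summable_on range int"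
    by (subst summable_on_reindex) (auto simp: o_def nat inj_on_def)
  moreover have "(\<lambda>n::int. 1 / (of_int n)\<^sup>2 :: real) summable_on range (\<lambda>n. - int n)"
    by (subst summable_on_reindex) (auto simp: o_def nat inj_on_def)
  ultimately have "(\<lambda>n::int. 1 / (of_int n)\<^sup>2 :: real) summable_on (range int \<union> range (\<lambda>n. - int n))"
    by (rule summable_on_union)
  moreover have "range int \<union> range (\<lambda>n. - int n) = UNIV"
  proof (intro subset_antisym subset_UNIV subsetI)
    show "n \<in> range int \<union> range (\<lambda>n. - int n)" for n
      by (cases n rule: int_cases2) auto
  qed
  ultimately show ?thesis by simp
qed

lemma inverse_squares_tail:
  assumes "0 < e"
  shows "\<exists>F :: int set. finite F \<and> 0 \<in> F \<and>
    (\<forall>G. finite G \<longrightarrow> G \<inter> F = {} \<longrightarrow> (\<Sum>n\<in>G. 1 / (of_int n)\<^sup>2 :: real) \<le> e)"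
proof -
  let ?f = "\<lambda>n::int. 1 / (of_int n)\<^sup>2 :: real"
  obtain F where F: "finite F" "dist (sum ?f F) (infsum ?f UNIV) \<le> e"
    using has_sum_finite_approximation[OF has_sum_infsum[OF summable_inverse_squares_int] assms] by blast
  show ?thesis
  proof (intro exI[of _ "insert 0 F"] conjI allI impI)
    fix G :: "int set" assume G: "finite G" "G \<inter> insert 0 F = {}"
    have "sum ?f G + sum ?f F = sum ?f (G \<union> F)"
      using F G by (intro sum.union_disjoint[symmetric]) auto
    also have "\<dots> \<le> infsum ?f UNIV"
      using F G by (intro finite_sum_le_infsum summable_inverse_squares_int) auto
    finally show "sum ?f G \<le> e"
      using F(2) by (simp add: dist_real_def abs_le_iff)
  qed (use F in auto)
qed

section \<open>The \<open>q\<close>-derivative\<close>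

lemma q_int_minus: "q_int q (- n) = - q_int q n"
  by (simp add: q_int_def diff_divide_distrib)

lemma q_int_0: "q_int q 0 = 0"
  by (simp add: q_int_def)

text \<open>The induction goes in steps of two, since \<open>[n+2] - [n] = q\<^sup>n\<^sup>+\<^sup>1 + q\<^sup>-\<^sup>n\<^sup>-\<^sup>1\<close>, which is at least \<open>2\<close>.\<close>

lemma q_int_nat_ge:
  assumes "0 < q" "q \<le> 1"
  shows "real n \<le> q_int q (int n)"
proof (cases "q = 1")
  case True
  then show ?thesis by (simp add: q_int_def)
next
  case False
  have inv: "q - inverse q < 0"
    using one_less_inverse[of q] assms False by simp
  show ?thesis
  proof (induction n rule: nat_induct2)
    case 0
    then show ?case by (simp add: q_int_0)
  next
    case 1
    then show ?case using False inv by (simp add: q_int_def)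
  next
    case (step n)
    have nat: "q_int q (int m) = (q ^ m - inverse (q ^ m)) / (q - inverse q)" for m
      using False by (simp add: q_int_def power_int_minus)
    have "q_int q (int (n + 2)) = q_int q (int n) + (q ^ (n + 1) + inverse (q ^ (n + 1)))"
      using inv assms(1) unfolding nat by (simp add: field_simps)
    moreover have "2 \<le> t + inverse t" if "0 < t" for t :: real
      using sum_squares_bound[of t 1] that by (simp add: field_simps power2_eq_square)
    from this[of "q ^ (n + 1)"] have "2 \<le> q ^ (n + 1) + inverse (q ^ (n + 1))"
      using zero_less_power[OF assms(1)] by blast
    ultimately show ?case using step by simp
  qed
qed

lemma abs_q_int_ge:
  assumes "0 < q" "q \<le> 1"
  shows "\<bar>of_int n\<bar> \<le> \<bar>q_int q n\<bar>"
proof (cases n rule: int_cases2)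
  case (nonneg m)
  then show ?thesis using q_int_nat_ge[OF assms, of m] by simp
next
  case (nonpos m)
  then show ?thesis using q_int_nat_ge[OF assms, of m] by (simp add: q_int_minus)
qed

lemma is_q_derivative_unique:
  "is_q_derivative q T D \<Longrightarrow> is_q_derivative q T D' \<Longrightarrow> D = D'"
  by (rule bounded_ops_eqI) (auto simp: is_q_derivative_def)

lemma q_deriv_eqI: "is_q_derivative q T D \<Longrightarrow> q_deriv q T = D"
  unfolding q_deriv_def by (rule the_equality) (auto intro: is_q_derivative_unique)

lemma is_q_derivative_add:
  "is_q_derivative q S D \<Longrightarrow> is_q_derivative q T E \<Longrightarrow> is_q_derivative q (S + T) (D + E)"
  by (simp add: is_q_derivative_def bounded_ops_add entry_add algebra_simps)

lemma is_q_derivative_scale_op: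
  "is_q_derivative q T D \<Longrightarrow> is_q_derivative q (scale_op c T) (scale_op c D)"
  by (simp add: is_q_derivative_def bounded_ops_scale_op entry_scale_op algebra_simps)

text \<open>The sign from \<open>[-n] = -[n]\<close> cancels the one from conjugating \<open>\<i>\<close>.\<close>

lemma is_q_derivative_adj:
  assumes "T \<in> bounded_ops" "is_q_derivative q T D"
  shows "is_q_derivative q (adj T) (adj D)"
proof -
  have D: "D \<in> bounded_ops" "entry D k j = \<i> * of_real (q_int q (k - j)) * entry T k j" for j k
    using assms(2) by (auto simp: is_q_derivative_def)
  have "entry (adj D) j k = \<i> * of_real (q_int q (j - k)) * entry (adj T) j k" for j k
    using q_int_minus[of q "j - k"] by (simp add: entry_adj assms(1) D)
  then show ?thesis
    by (simp add: is_q_derivative_def adj_bounded_ops D(1))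
qed

lemma is_q_derivative_shift:
  "is_q_derivative q (shift n) (scale_op (\<i> * of_real (q_int q n)) (shift n))"
  by (auto simp: is_q_derivative_def bounded_ops_scale_op shift_bounded_ops entry_scale_op entry_shift)

lemma Lip_circle_iff: "T \<in> Lip_circle q \<longleftrightarrow> T \<in> C_circle \<and> (\<exists>D. is_q_derivative q T D)"
  using C_circle_bounded_ops by (auto simp: Lip_circle_def Lip_ell2_def)

lemma complex_subspace_Lip_circle: "complex_subspace (Lip_circle q)"
proof -
  have C: "complex_subspace C_circle"
    using unital_cstar_algebra_C_circle by (simp add: unital_cstar_algebra_def)
  have "is_q_derivative q 0 0"
    by (simp add: is_q_derivative_def bounded_ops_zero entry_zero)
  then show ?thesis
    using C by (auto simp: complex_subspace_def Lip_circle_iff)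
      (metis is_q_derivative_add is_q_derivative_scale_op)+
qed

lemma shift_in_Lip_circle: "shift n \<in> Lip_circle q"
  using is_q_derivative_shift[of q n] subsetD[OF closure_subset shift_in_laurent_polys]
  by (auto simp: Lip_circle_iff C_circle_eq_closure)

lemma operator_system_Lip_circle: "operator_system C_circle (Lip_circle q)"
  unfolding operator_system_def
proof (intro conjI ballI)
  show "adj x \<in> Lip_circle q" if "x \<in> Lip_circle q" for x
    using that is_q_derivative_adj[OF C_circle_bounded_ops] unital_cstar_algebra_C_circle
    by (auto simp: Lip_circle_iff unital_cstar_algebra_def)
  show "id_blinfun \<in> Lip_circle q"
    using shift_in_Lip_circle[of 0] by (simp add: shift_0)
  show "Lip_circle q \<subseteq> C_circle" by (auto simp: Lip_circle_def)
  show "unital_cstar_algebra C_circle" by (rule unital_cstar_algebra_C_circle)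
  show "complex_subspace (Lip_circle q)" by (rule complex_subspace_Lip_circle)
qed

lemma slip_norm_L_q: "slip_norm (Lip_circle q) (L_q q)"
  unfolding slip_norm_def
proof (intro conjI ballI allI)
  fix x assume x: "x \<in> Lip_circle q"
  then obtain D where D: "is_q_derivative q x D" and xb: "x \<in> bounded_ops"
    using C_circle_bounded_ops by (auto simp: Lip_circle_iff)
  show "L_q q (scale_op c x) = cmod c * L_q q x" for c
    using q_deriv_eqI[OF D] q_deriv_eqI[OF is_q_derivative_scale_op[OF D, of c]]
    by (simp add: L_q_def norm_scale_op)
  show "L_q q (adj x) = L_q q x"
    using q_deriv_eqI[OF D] q_deriv_eqI[OF is_q_derivative_adj[OF xb D]] norm_adj[of D] D
    by (simp add: L_q_def is_q_derivative_def)
  fix y assume "y \<in> Lip_circle q"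
  then obtain E where E: "is_q_derivative q y E" by (auto simp: Lip_circle_iff)
  show "L_q q (x + y) \<le> L_q q x + L_q q y"
    using q_deriv_eqI[OF D] q_deriv_eqI[OF E] q_deriv_eqI[OF is_q_derivative_add[OF D E]]
    by (simp add: L_q_def norm_triangle_ineq)
next
  show "L_q q id_blinfun = 0"
    using q_deriv_eqI[OF is_q_derivative_shift[of q 0]]
    by (simp add: L_q_def shift_0 q_int_0 norm_scale_op)
qed (simp add: L_q_def)

lemma subspace_Lip_circle: "subspace (Lip_circle q)"
  by (rule complex_subspace_imp_subspace[OF complex_subspace_Lip_circle])

lemma monomial_in_Lip_circle: "scale_op c (shift n) \<in> Lip_circle q"
  using complex_subspace_Lip_circle[of q] shift_in_Lip_circle by (simp add: complex_subspace_def)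

lemma closure_Lip_circle: "closure (Lip_circle q) = C_circle"
proof
  show "closure (Lip_circle q) \<subseteq> C_circle"
    by (rule closure_minimal) (auto simp: Lip_circle_def C_circle_eq_closure)
  have "laurent_polys \<subseteq> Lip_circle q"
    unfolding laurent_polys_def
    by (rule span_minimal[OF _ subspace_Lip_circle]) (auto simp: monomial_in_Lip_circle)
  then show "C_circle \<subseteq> closure (Lip_circle q)"
    unfolding C_circle_eq_closure by (rule closure_mono)
qed

section \<open>Total boundedness of the Lipschitz ball modulo scalars\<close>

text \<open>The column of \<open>d\<^sub>q(T)\<close> at \<open>e\<^sub>0\<close> has the coordinates \<open>\<i> [n] t\<^sub>n\<close>, where \<open>t\<close> is the
  sequence of Fourier coefficients of \<open>T\<close>, and its norm is at most the operator norm.\<close>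

lemma Lip_ball_Fourier_coefficients:
  assumes q: "0 < q" "q \<le> 1" and T: "T \<in> Lip_circle q" "L_q q T \<le> 1" and G: "finite G"
  shows "(\<Sum>n\<in>G. (of_int n)\<^sup>2 * (cmod (entry T n 0))\<^sup>2) \<le> 1"
proof -
  obtain D where D: "is_q_derivative q T D" using T by (auto simp: Lip_circle_iff)
  have nD: "norm D \<le> 1" using T(2) q_deriv_eqI[OF D] by (simp add: L_q_def)
  let ?v = "blinfun_apply D (basis_vec 0)"
  have "(of_int n)\<^sup>2 * (cmod (entry T n 0))\<^sup>2 \<le> (cmod (coord ?v n))\<^sup>2" for n
  proof -
    have "coord ?v n = \<i> * of_real (q_int q n) * entry T n 0"
      using D by (simp add: is_q_derivative_def flip: entry_eq_coord)
    then have "(cmod (coord ?v n))\<^sup>2 = \<bar>q_int q n\<bar>\<^sup>2 * (cmod (entry T n 0))\<^sup>2"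
      by (simp add: norm_mult power_mult_distrib)
    moreover have "\<bar>of_int n\<bar>\<^sup>2 \<le> \<bar>q_int q n\<bar>\<^sup>2"
      by (rule power_mono[OF abs_q_int_ge[OF q]]) simp
    ultimately show ?thesis by (simp add: mult_right_mono)
  qed
  then have "(\<Sum>n\<in>G. (of_int n)\<^sup>2 * (cmod (entry T n 0))\<^sup>2) \<le> (\<Sum>n\<in>G. (cmod (coord ?v n))\<^sup>2)"
    by (intro sum_mono)
  also have "\<dots> \<le> (norm ?v)\<^sup>2" by (rule sum_coord_le_norm[OF G])
  also have "norm ?v \<le> 1"
    using norm_blinfun[of D "basis_vec 0"] nD by (simp add: norm_basis_vec)
  then have "(norm ?v)\<^sup>2 \<le> 1" by (simp add: power_le_one)
  finally show ?thesis .
qed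

lemma Lip_ball_coefficient_le_1:
  assumes q: "0 < q" "q \<le> 1" and T: "T \<in> Lip_circle q" "L_q q T \<le> 1" and n: "n \<noteq> 0"
  shows "cmod (entry T n 0) \<le> 1"
proof -
  have "0 < n\<^sup>2" using n by simp
  then have "1 \<le> n\<^sup>2" by linarith
  then have "1 \<le> (of_int n :: real)\<^sup>2"
    by (metis of_int_1_le_iff of_int_power)
  then have "(cmod (entry T n 0))\<^sup>2 \<le> (of_int n)\<^sup>2 * (cmod (entry T n 0))\<^sup>2"
    using mult_right_mono[of 1 "(of_int n)\<^sup>2" "(cmod (entry T n 0))\<^sup>2"] by simp
  also have "\<dots> \<le> 1" using Lip_ball_Fourier_coefficients[OF q T, of "{n}"] by simp
  finally have "(cmod (entry T n 0))\<^sup>2 \<le> 1\<^sup>2" by simp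
  then show ?thesis by (rule power2_le_imp_le) simp
qed

text \<open>A finite set \<open>F\<close> of frequencies is chosen so that the remaining ones contribute at most \<open>e/2\<close> in
  norm, uniformly over the ball. The constant term is absorbed in the scalar \<open>c\<close>: it is the
  only coefficient that \<open>L\<^sub>q\<close> does not control.\<close>

lemma Lip_ball_finite_net:
  assumes q: "0 < q" "q \<le> 1" and e: "0 < e"
  shows "\<exists>N. finite N \<and> N \<subseteq> Lip_circle q \<and> (\<forall>x\<in>Lip_circle q. L_q q x \<le> 1 \<longrightarrow>
     (\<exists>y\<in>N. \<exists>c. norm (x - (y + scale_op c id_blinfun)) \<le> e))"
proof -
  have e2: "0 < (e/2)\<^sup>2" using e by simp
  obtain F :: "int set" where F: "finite F" "0 \<in> F"
    and tail: "\<And>G. finite G \<Longrightarrow> G \<inter> F = {} \<Longrightarrow> (\<Sum>n\<in>G. 1 / (of_int n)\<^sup>2 :: real) \<le> (e/2)\<^sup>2"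
    using inverse_squares_tail[OF e2] by (elim exE conjE) simp
  define F' where "F' = F - {0}"
  define K where "K = {\<Sum>n\<in>F'. scale_op (c n) (shift n) | c. \<forall>n\<in>F'. cmod (c n) \<le> 1}"
  have "compact K" unfolding K_def F'_def using F by (intro compact_trigonometric_polys) auto
  then obtain N where N: "finite N" "N \<subseteq> K" "K \<subseteq> (\<Union>x\<in>N. ball x (e/2))"
    using seq_compact_imp_totally_bounded[of K] e compact_imp_seq_compact by (meson half_gt_zero)
  have "K \<subseteq> Lip_circle q"
    by (auto simp: K_def monomial_in_Lip_circle intro: subspace_sum[OF subspace_Lip_circle])
  moreover have "\<exists>y\<in>N. \<exists>c. norm (x - (y + scale_op c id_blinfun)) \<le> e"
    if x: "x \<in> Lip_circle q" "L_q q x \<le> 1" for x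
  proof -
    define t where "t n = entry x n 0" for n
    define z where "z = (\<Sum>n\<in>F'. scale_op (t n) (shift n))"
    have "z \<in> K"
      unfolding K_def mem_Collect_eq
      by (intro exI[of _ t] conjI) (auto simp: z_def t_def F'_def intro: Lip_ball_coefficient_le_1[OF q x])
    then obtain y where y: "y \<in> N" "norm (z - y) \<le> e/2"
      using N(3) by (auto simp: dist_norm norm_minus_commute less_imp_le)
    define S where "S = x - (z + scale_op (t 0) id_blinfun)"
    have xC: "x \<in> C_circle" using x by (simp add: Lip_circle_def)
    have zt: "z + scale_op (t 0) id_blinfun = (\<Sum>n\<in>F. scale_op (t n) (shift n))"
      unfolding z_def F'_def using F by (simp add: sum.remove[of F 0] shift_0 add.commute)
    have "norm S \<le> e/2"
    proof (rule norm_le_sum_Fourier)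
      show "S \<in> bounded_ops"
        unfolding S_def zt
        by (intro bounded_ops_minus C_circle_bounded_ops xC subspace_sum[OF subspace_bounded_ops]
            bounded_ops_scale_op shift_bounded_ops)
      fix j k
      have "entry (\<Sum>n\<in>F. scale_op (t n) (shift n)) j k = (\<Sum>n\<in>F. entry (scale_op (t n) (shift n)) j k)"
        by (rule linear_sum[OF bounded_linear.linear[OF bounded_linear_entry]])
      also have "\<dots> = (\<Sum>n\<in>F. if n = j - k then t n else 0)"
        by (intro sum.cong) (auto simp: entry_scale_op entry_shift)
      also have "\<dots> = (if j - k \<in> F then t (j - k) else 0)"
        using F(1) by simp
      finally show "entry S j k = (\<lambda>n. if n \<in> F then 0 else t n) (j - k)"
        using entry_C_circle[OF xC, of j k] unfolding S_def zt entry_minus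
        by (simp add: t_def)
    next
      fix G :: "int set" assume G: "finite G"
      have "(\<Sum>n\<in>G. cmod (if n \<in> F then 0 else t n)) = (\<Sum>n\<in>G - F. cmod (t n))"
        using G by (simp add: sum.If_cases if_distrib Diff_eq cong: if_cong)
      also have "\<dots> = (\<Sum>n\<in>G - F. \<bar>of_int n\<bar> * cmod (t n) * (1 / \<bar>of_int n\<bar>))"
        using F(2) by (intro sum.cong) auto
      finally have eq: "(\<Sum>n\<in>G. cmod (if n \<in> F then 0 else t n))
          = (\<Sum>n\<in>G - F. \<bar>of_int n\<bar> * cmod (t n) * (1 / \<bar>of_int n\<bar>))" .
      have "(\<Sum>n\<in>G - F. \<bar>of_int n\<bar> * cmod (t n) * (1 / \<bar>of_int n\<bar>))\<^sup>2
          \<le> (\<Sum>n\<in>G - F. (\<bar>of_int n\<bar> * cmod (t n))\<^sup>2) * (\<Sum>n\<in>G - F. (1 / \<bar>of_int n\<bar>)\<^sup>2)"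
        by (rule Cauchy_Schwarz_ineq_sum)
      also have "\<dots> \<le> 1 * (e/2)\<^sup>2"
      proof (rule mult_mono)
        show "(\<Sum>n\<in>G - F. (\<bar>of_int n\<bar> * cmod (t n))\<^sup>2) \<le> 1"
          using Lip_ball_Fourier_coefficients[OF q x, of "G - F"] G
          by (simp add: power_mult_distrib t_def)
        show "(\<Sum>n\<in>G - F. (1 / \<bar>of_int n\<bar>)\<^sup>2) \<le> (e/2)\<^sup>2"
          using tail[of "G - F"] G by (auto simp: power_divide)
      qed (auto intro: sum_nonneg)
      finally show "(\<Sum>n\<in>G. cmod (if n \<in> F then 0 else t n)) \<le> e/2"
        unfolding eq by (rule power2_le_imp_le[of _ "e/2", OF ord_le_eq_trans]) (use e in auto)
    qed
    moreover have "x - (y + scale_op (t 0) id_blinfun) = S + (z - y)"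
      by (simp add: S_def)
    then have "norm (x - (y + scale_op (t 0) id_blinfun)) \<le> norm S + norm (z - y)"
      using norm_triangle_ineq[of S "z - y"] by (simp only:)
    ultimately have "norm (x - (y + scale_op (t 0) id_blinfun)) \<le> e"
      using y(2) by simp
    then show ?thesis using y(1) by blast
  qed
  ultimately show ?thesis using N by blast
qed

theorem theorem6p12:
  fixes q :: real
  assumes "0 < q" and "q \<le> 1"
  shows "quantum_metric_on C_circle (Lip_circle q) (L_q q) C_circle"
  unfolding quantum_metric_on_def
  using compact_quantum_metric_spaceI[OF operator_system_Lip_circle slip_norm_L_q
      Lip_ball_finite_net[OF assms]] closure_Lip_circle
  by blast

end
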